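(* Let $H$ be a finite dimensional Hopf algebra such that $H$ is semisimple and $H^*$ is unimodular, and let $\mathcal{A}$ be an $H$-bimodule algebra. Then: (i) if $V$ is a left $\mathcal{A}\natural H$-module and $W\subseteq V$ is an $\mathcal{A}\natural H$-submodule which has a complement in $V$ as left $\mathcal{A}$-modules, then $W$ has a complement in $V$ as left $\mathcal{A}\natural H$-modules; (ii) if $\mathcal{A}$ is semisimple Artinian, then so is $\mathcal{A}\natural H$.
   Context: Work over a field $k$; $H$ an ordinary Hopf algebra, $\Delta(h)=h_1\otimes h_2$. An $H$-bimodule algebra is an associative unital algebra $\mathcal{A}$ which is an $H$-bimodule (actions $h\cdot\varphi$, $\varphi\cdot h$) with $h\cdot(\varphi\psi)=(h_1\cdot\varphi)(h_2\cdot\psi)$, $(\varphi\psi)\cdot h=(\varphi\cdot h_1)(\psi\cdot h_2)$, $h\cdot1=1\cdot h=\varepsilon(h)1$. The L-R-smash product $\mathcal{A}\natural H$ is $\mathcal{A}\otimes H$ with product $(\varphi\natural h)(\psi\natural h')=(\varphi\cdot h'_2)(h_1\cdot\psi)\natural h_2h'_1$ and unit $1\natural1$; an $\mathcal{A}\natural H$-module is an $\mathcal{A}$-module via the algebra map $\varphi\mapsto\varphi\natural1$. $H^*$ unimodular means its spaces of left and right integrals coincide (equivalently the distinguished group-like element of $H$ is $1$). *)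

theory Defs
  imports "HOL-Algebra.AbelCoset" "HOL-Library.Function_Algebras"
begin

text \<open>A finite dimensional Hopf algebra H over the field 'k is given by a basis
 e_i indexed by the finite type 'n; an element of H is its coordinate vector
 'n => 'k.  Structure constants:
   e_i e_j = sum_l (m i j l) e_l,           1_H = sum_l (u l) e_l,
   Delta(e_i) = sum_(a,b) (d i a b) e_a (x) e_b,   eps(e_i) = eps i,
   S(e_i) = sum_j (S i j) e_j.\<close>

definition hopf_alg ::
  "('n::finite \<Rightarrow> 'n \<Rightarrow> 'n \<Rightarrow> 'k::field) \<Rightarrow> ('n \<Rightarrow> 'k) \<Rightarrow>
   ('n \<Rightarrow> 'n \<Rightarrow> 'n \<Rightarrow> 'k) \<Rightarrow> ('n \<Rightarrow> 'k) \<Rightarrow> ('n \<Rightarrow> 'n \<Rightarrow> 'k) \<Rightarrow> bool" where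
  "hopf_alg m u d eps S \<longleftrightarrow>
     \<comment> \<open>associativity\<close>
     (\<forall>i j l t. (\<Sum>p\<in>UNIV. m i j p * m p l t) = (\<Sum>p\<in>UNIV. m j l p * m i p t)) \<and>
     \<comment> \<open>unit\<close>
     (\<forall>i t. (\<Sum>p\<in>UNIV. u p * m p i t) = (if i = t then 1 else 0)) \<and>
     (\<forall>i t. (\<Sum>p\<in>UNIV. u p * m i p t) = (if i = t then 1 else 0)) \<and>
     \<comment> \<open>coassociativity\<close>
     (\<forall>i a b l. (\<Sum>p\<in>UNIV. d i p l * d p a b) = (\<Sum>p\<in>UNIV. d i a p * d p b l)) \<and>
     \<comment> \<open>counit\<close>
     (\<forall>i b. (\<Sum>a\<in>UNIV. d i a b * eps a) = (if i = b then 1 else 0)) \<and>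
     (\<forall>i a. (\<Sum>b\<in>UNIV. d i a b * eps b) = (if i = a then 1 else 0)) \<and>
     \<comment> \<open>Delta is an algebra map\<close>
     (\<forall>i j a b. (\<Sum>p\<in>UNIV. m i j p * d p a b) =
        (\<Sum>a1\<in>UNIV. \<Sum>b1\<in>UNIV. \<Sum>a2\<in>UNIV. \<Sum>b2\<in>UNIV. d i a1 b1 * d j a2 b2 * m a1 a2 a * m b1 b2 b)) \<and>
     (\<forall>a b. (\<Sum>p\<in>UNIV. u p * d p a b) = u a * u b) \<and>
     \<comment> \<open>eps is an algebra map\<close>
     (\<forall>i j. (\<Sum>p\<in>UNIV. m i j p * eps p) = eps i * eps j) \<and>
     (\<Sum>p\<in>UNIV. u p * eps p) = 1 \<and>
     \<comment> \<open>antipode: S(h_1) h_2 = eps(h) 1 = h_1 S(h_2)\<close>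
     (\<forall>i t. (\<Sum>a\<in>UNIV. \<Sum>b\<in>UNIV. \<Sum>c\<in>UNIV. d i a b * S a c * m c b t) = eps i * u t) \<and>
     (\<forall>i t. (\<Sum>a\<in>UNIV. \<Sum>b\<in>UNIV. \<Sum>c\<in>UNIV. d i a b * S b c * m a c t) = eps i * u t)"

definition hmul :: "('n::finite \<Rightarrow> 'n \<Rightarrow> 'n \<Rightarrow> 'k::field) \<Rightarrow> ('n \<Rightarrow> 'k) \<Rightarrow> ('n \<Rightarrow> 'k) \<Rightarrow> ('n \<Rightarrow> 'k)" where
  "hmul m x y = (\<lambda>l. \<Sum>i\<in>UNIV. \<Sum>j\<in>UNIV. x i * y j * m i j l)"

definition H_ring :: "('n::finite \<Rightarrow> 'n \<Rightarrow> 'n \<Rightarrow> 'k::field) \<Rightarrow> ('n \<Rightarrow> 'k) \<Rightarrow> ('n \<Rightarrow> 'k) ring" where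
  "H_ring m u = \<lparr>carrier = UNIV, monoid.mult = hmul m, one = u, zero = 0, add = (+)\<rparr>"

text \<open>Dual H^*: functionals f : H -> k, given by their values f i = f(e_i).
  Convolution (f g)(h) = f(h_1) g(h_2); the counit of H^* is f |-> f(1_H).
  Left integral L: g L = g(1_H) L for all g; right integral: L g = g(1_H) L.\<close>

definition dual_left_integral :: "('n::finite \<Rightarrow> 'k::field) \<Rightarrow> ('n \<Rightarrow> 'n \<Rightarrow> 'n \<Rightarrow> 'k) \<Rightarrow> ('n \<Rightarrow> 'k) \<Rightarrow> bool" where
  "dual_left_integral u d L \<longleftrightarrow>
     (\<forall>g i. (\<Sum>a\<in>UNIV. \<Sum>b\<in>UNIV. d i a b * g a * L b) = (\<Sum>l\<in>UNIV. u l * g l) * L i)"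

definition dual_right_integral :: "('n::finite \<Rightarrow> 'k::field) \<Rightarrow> ('n \<Rightarrow> 'n \<Rightarrow> 'n \<Rightarrow> 'k) \<Rightarrow> ('n \<Rightarrow> 'k) \<Rightarrow> bool" where
  "dual_right_integral u d L \<longleftrightarrow>
     (\<forall>g i. (\<Sum>a\<in>UNIV. \<Sum>b\<in>UNIV. d i a b * L a * g b) = (\<Sum>l\<in>UNIV. u l * g l) * L i)"

definition dual_unimodular :: "('n::finite \<Rightarrow> 'k::field) \<Rightarrow> ('n \<Rightarrow> 'n \<Rightarrow> 'n \<Rightarrow> 'k) \<Rightarrow> bool" where
  "dual_unimodular u d \<longleftrightarrow> {L. dual_left_integral u d L} = {L. dual_right_integral u d L}"

definition left_ideal :: "('r, 'm) ring_scheme \<Rightarrow> 'r set \<Rightarrow> bool" where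
  "left_ideal R L \<longleftrightarrow> additive_subgroup L R \<and> (\<forall>a\<in>carrier R. \<forall>x\<in>L. a \<otimes>\<^bsub>R\<^esub> x \<in> L)"

text \<open>R is semisimple Artinian iff the left regular module R is semisimple, i.e.
  every left ideal is a direct summand (has a complementary left ideal).\<close>

definition semisimple_artinian :: "('r, 'm) ring_scheme \<Rightarrow> bool" where
  "semisimple_artinian R \<longleftrightarrow> ring R \<and>
     (\<forall>L. left_ideal R L \<longrightarrow>
        (\<exists>L'. left_ideal R L' \<and> L \<inter> L' = {\<zero>\<^bsub>R\<^esub>} \<and>
              (\<forall>x\<in>carrier R. \<exists>a\<in>L. \<exists>b\<in>L'. x = a \<oplus>\<^bsub>R\<^esub> b)))"

definition k_algebra :: "('k::field \<Rightarrow> 'a::ring_1 \<Rightarrow> 'a) \<Rightarrow> bool" where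
  "k_algebra sc \<longleftrightarrow>
     (\<forall>c x y. sc c (x + y) = sc c x + sc c y) \<and>
     (\<forall>c e x. sc (c + e) x = sc c x + sc e x) \<and>
     (\<forall>c e x. sc (c * e) x = sc c (sc e x)) \<and>
     (\<forall>x. sc 1 x = x) \<and>
     (\<forall>c x y. sc c (x * y) = sc c x * y \<and> sc c (x * y) = x * sc c y)"

definition A_ring :: "('a::ring_1) ring" where
  "A_ring = \<lparr>carrier = UNIV, monoid.mult = (*), one = 1, zero = 0, add = (+)\<rparr>"

text \<open>lact i x = e_i . x and ract x i = x . e_i; for general h in H,
  h . x = sum_i (h i) (lact i x) and x . h = sum_i (h i) (ract x i).\<close>

definition bimodule_algebra ::
  "('n::finite \<Rightarrow> 'n \<Rightarrow> 'n \<Rightarrow> 'k::field) \<Rightarrow> ('n \<Rightarrow> 'k) \<Rightarrow> ('n \<Rightarrow> 'n \<Rightarrow> 'n \<Rightarrow> 'k) \<Rightarrow> ('n \<Rightarrow> 'k) \<Rightarrow>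
   ('k \<Rightarrow> 'a::ring_1 \<Rightarrow> 'a) \<Rightarrow> ('n \<Rightarrow> 'a \<Rightarrow> 'a) \<Rightarrow> ('a \<Rightarrow> 'n \<Rightarrow> 'a) \<Rightarrow> bool" where
  "bimodule_algebra m u d eps sc lact ract \<longleftrightarrow>
     k_algebra sc \<and>
     \<comment> \<open>linearity of the actions\<close>
     (\<forall>i x y. lact i (x + y) = lact i x + lact i y) \<and>
     (\<forall>i c x. lact i (sc c x) = sc c (lact i x)) \<and>
     (\<forall>i x y. ract (x + y) i = ract x i + ract y i) \<and>
     (\<forall>i c x. ract (sc c x) i = sc c (ract x i)) \<and>
     \<comment> \<open>left module\<close>
     (\<forall>i j x. lact i (lact j x) = (\<Sum>l\<in>UNIV. sc (m i j l) (lact l x))) \<and>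
     (\<forall>x. (\<Sum>l\<in>UNIV. sc (u l) (lact l x)) = x) \<and>
     \<comment> \<open>right module\<close>
     (\<forall>i j x. ract (ract x i) j = (\<Sum>l\<in>UNIV. sc (m i j l) (ract x l))) \<and>
     (\<forall>x. (\<Sum>l\<in>UNIV. sc (u l) (ract x l)) = x) \<and>
     \<comment> \<open>bimodule\<close>
     (\<forall>i j x. lact i (ract x j) = ract (lact i x) j) \<and>
     \<comment> \<open>compatibility with the algebra structure\<close>
     (\<forall>i x y. lact i (x * y) = (\<Sum>a\<in>UNIV. \<Sum>b\<in>UNIV. sc (d i a b) (lact a x * lact b y))) \<and>
     (\<forall>i x y. ract (x * y) i = (\<Sum>a\<in>UNIV. \<Sum>b\<in>UNIV. sc (d i a b) (ract x a * ract y b))) \<and>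
     (\<forall>i. lact i 1 = sc (eps i) 1) \<and>
     (\<forall>i. ract 1 i = sc (eps i) 1)"

text \<open>An element of A natural H is written sum_i (x i) natural e_i, i.e. x :: 'n => 'a.
  (phi nat e_i)(psi nat e_j) = (phi . (e_j)_2)((e_i)_1 . psi) nat (e_i)_2 (e_j)_1.\<close>

definition smash_mult ::
  "('n::finite \<Rightarrow> 'n \<Rightarrow> 'n \<Rightarrow> 'k::field) \<Rightarrow> ('n \<Rightarrow> 'n \<Rightarrow> 'n \<Rightarrow> 'k) \<Rightarrow>
   ('k \<Rightarrow> 'a::ring_1 \<Rightarrow> 'a) \<Rightarrow> ('n \<Rightarrow> 'a \<Rightarrow> 'a) \<Rightarrow> ('a \<Rightarrow> 'n \<Rightarrow> 'a) \<Rightarrow>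
   ('n \<Rightarrow> 'a) \<Rightarrow> ('n \<Rightarrow> 'a) \<Rightarrow> ('n \<Rightarrow> 'a)" where
  "smash_mult m d sc lact ract x y =
     (\<lambda>l. \<Sum>i\<in>UNIV. \<Sum>j\<in>UNIV. \<Sum>a\<in>UNIV. \<Sum>b\<in>UNIV. \<Sum>c\<in>UNIV. \<Sum>e\<in>UNIV.
        sc (d i a b * d j c e * m b c l) (ract (x i) e * lact a (y j)))"

definition smash_emb :: "('n::finite \<Rightarrow> 'k::field) \<Rightarrow> ('k \<Rightarrow> 'a::ring_1 \<Rightarrow> 'a) \<Rightarrow> 'a \<Rightarrow> ('n \<Rightarrow> 'a)" where
  "smash_emb u sc x = (\<lambda>i. sc (u i) x)"

definition smash_ring ::
  "('n::finite \<Rightarrow> 'n \<Rightarrow> 'n \<Rightarrow> 'k::field) \<Rightarrow> ('n \<Rightarrow> 'k) \<Rightarrow> ('n \<Rightarrow> 'n \<Rightarrow> 'n \<Rightarrow> 'k) \<Rightarrow>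
   ('k \<Rightarrow> 'a::ring_1 \<Rightarrow> 'a) \<Rightarrow> ('n \<Rightarrow> 'a \<Rightarrow> 'a) \<Rightarrow> ('a \<Rightarrow> 'n \<Rightarrow> 'a) \<Rightarrow> ('n \<Rightarrow> 'a) ring" where
  "smash_ring m u d sc lact ract =
     \<lparr>carrier = UNIV, monoid.mult = smash_mult m d sc lact ract,
      one = smash_emb u sc 1, zero = 0, add = (+)\<rparr>"

definition lmodule :: "('r, 'm) ring_scheme \<Rightarrow> ('r \<Rightarrow> 'v::ab_group_add \<Rightarrow> 'v) \<Rightarrow> bool" where
  "lmodule R act \<longleftrightarrow>
     (\<forall>r\<in>carrier R. \<forall>v w. act r (v + w) = act r v + act r w) \<and>
     (\<forall>r\<in>carrier R. \<forall>s\<in>carrier R. \<forall>v. act (r \<oplus>\<^bsub>R\<^esub> s) v = act r v + act s v) \<and>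
     (\<forall>r\<in>carrier R. \<forall>s\<in>carrier R. \<forall>v. act (r \<otimes>\<^bsub>R\<^esub> s) v = act r (act s v)) \<and>
     (\<forall>v. act \<one>\<^bsub>R\<^esub> v = v)"

definition submodule_of :: "('r, 'm) ring_scheme \<Rightarrow> ('r \<Rightarrow> 'v::ab_group_add \<Rightarrow> 'v) \<Rightarrow> 'v set \<Rightarrow> bool" where
  "submodule_of R act W \<longleftrightarrow>
     0 \<in> W \<and> (\<forall>x\<in>W. \<forall>y\<in>W. x + y \<in> W) \<and> (\<forall>x\<in>W. - x \<in> W) \<and>
     (\<forall>r\<in>carrier R. \<forall>x\<in>W. act r x \<in> W)"

definition has_complement :: "('r, 'm) ring_scheme \<Rightarrow> ('r \<Rightarrow> 'v::ab_group_add \<Rightarrow> 'v) \<Rightarrow> 'v set \<Rightarrow> bool" where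
  "has_complement R act W \<longleftrightarrow>
     (\<exists>W'. submodule_of R act W' \<and> W \<inter> W' = {0} \<and> (\<forall>v. \<exists>x\<in>W. \<exists>y\<in>W'. v = x + y))"

end

theory Submission
  imports Defs "HOL.Modules"
begin

text \<open>Semisimplicity of H yields a two-sided integral t with eps(t) = 1, and S(t) = t. Given a
  projection p of V onto W that is linear over A, average it to P(v) = t_1 p(S(t_2) v). The Casimir
  property of t_1 \<otimes> S(t_2) makes P linear over H. In the smash product
  S(t) phi = (S(t_3) . phi . t_1) S(t_2), so linearity over A comes down to
  t_1 S(t_3) \<otimes> t_2 = 1 \<otimes> t. This is where unimodularity of the dual enters: the trace
  lam(h) = Tr(x |-> h S(S(x))) is a left integral on H with lam(t) = 1, hence also a right one, and
  applying lam(h _) to the second tensor factor gives eps(h) on both sides. Since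
  x = S(t_1) lam(t_2 x), such functionals separate points and S is onto, so that
  psi # S(g) = (psi . g_1) S(g_2) shows that A and H generate the smash product. Consequently P is
  linear over it. For part (ii) the smash product is a finitely generated A-module, so each of its
  left ideals has a complement over A and part (i) applies.\<close>

section \<open>Linear maps on coordinate vectors\<close>

text \<open>Writing out P(phi v) for phi in the algebra consumes five legs of t. The leg t_3 acting
  on phi from the right is exactly the one that phi \<natural> 1 picks up when it is multiplied by 1
  \<natural> t_2, so the right action needs no correction. The left action, however, leaves phi
  translated by t_1 S(t_5). The antipode axiom cannot remove this product, because its factors are
  separated by t_2, t_3, t_4. This is the obstacle that the identity for t_1 S(t_3) \<otimes> t_2
  overcomes.

  The explicit trace \<open>lam\<close> takes the place of an abstract integral of the dual. Its
  invariance and lam(t) = 1 make S(t_1) and t_2 dual bases for the form lam(yx); both the separation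
  of points and the surjectivity of S are read off from this.

  Identities in tensor powers of H are expressed by applying arbitrary multilinear maps with values
  in a vector space with scalar multiplication \<open>s\<close>. The same statement then serves for
  the field, for H, for the algebra, for the smash product and for V.\<close>

definition pw :: "('k \<Rightarrow> 'v \<Rightarrow> 'v) \<Rightarrow> 'k \<Rightarrow> ('n \<Rightarrow> 'v) \<Rightarrow> 'n \<Rightarrow> 'v" where
  "pw s c x = (\<lambda>i. s c (x i))"

lemma pw_apply: "pw s c x i = s c (x i)"
  by (simp add: pw_def)

definition bas :: "'n \<Rightarrow> 'n \<Rightarrow> 'k::zero_neq_one" where
  "bas i = (\<lambda>j. if j = i then 1 else 0)"

lemma bas_apply: "bas i j = (if i = j then 1 else 0)"
  by (auto simp: bas_def)

text \<open>The clause \<open>module s\<close> belongs to linearity so that a linear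
  \<open>f\<close> brings along the laws of its target, which changes from one application to the
  next.\<close>

definition lin :: "('k::field \<Rightarrow> 'v \<Rightarrow> 'v) \<Rightarrow> (('n \<Rightarrow> 'k) \<Rightarrow> 'v::ab_group_add) \<Rightarrow> bool" where
  "lin s f \<longleftrightarrow> module s \<and> (\<forall>x y. f (x + y) = f x + f y) \<and> (\<forall>c x. f (pw (*) c x) = s c (f x))"

named_theorems lin_intro

lemma linI:
  "\<lbrakk>module s; \<And>x y. f (x + y) = f x + f y; \<And>c x. f (pw (*) c x) = s c (f x)\<rbrakk> \<Longrightarrow> lin s f"
  by (simp add: lin_def)

lemma lin_add: "lin s f \<Longrightarrow> f (x + y) = f x + f y"
  and lin_scale: "lin s f \<Longrightarrow> f (pw (*) c x) = s c (f x)"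
  and lin_module: "lin s f \<Longrightarrow> module s"
  by (simp_all add: lin_def)

lemma module_mult [lin_intro]: "module ((*) :: 'k::field \<Rightarrow> 'k \<Rightarrow> 'k)"
  by unfold_locales (simp_all add: algebra_simps)

lemma module_pw [lin_intro]:
  assumes "module s" shows "module (pw s)"
proof -
  interpret module s by fact
  show ?thesis
    by unfold_locales (simp_all add: pw_def fun_eq_iff scale_right_distrib scale_left_distrib)
qed

lemma additive_sum:
  fixes f :: "'b::ab_group_add \<Rightarrow> 'c::ab_group_add"
  assumes "\<And>x y. f (x + y) = f x + f y"
  shows "f (sum g A) = (\<Sum>x\<in>A. f (g x))"
  by (rule additive.sum) (simp add: additive_def assms)

lemma lin_sum: "lin s f \<Longrightarrow> f (sum g A) = (\<Sum>x\<in>A. f (g x))"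
  by (rule additive_sum[of f]) (simp add: lin_def)

lemma sum_fun_apply: "(sum f A) x = (\<Sum>a\<in>A. f a x)"
  by (induction A rule: infinite_finite_induct) auto

lemma bas_expand: "x = (\<Sum>i\<in>UNIV. pw (*) (x i) (bas (i::'n::finite)) :: 'n \<Rightarrow> 'k::field)"
  by (simp add: fun_eq_iff sum_fun_apply pw_def bas_def if_distrib cong: if_cong)

lemma lin_expand:
  fixes x :: "'n::finite \<Rightarrow> 'k::field"
  assumes "lin s f"
  shows "f x = (\<Sum>i\<in>UNIV. s (x i) (f (bas i)))"
proof -
  have "f x = f (\<Sum>i\<in>UNIV. pw (*) (x i) (bas i))" using bas_expand[of x] by (rule arg_cong)
  also have "\<dots> = (\<Sum>i\<in>UNIV. s (x i) (f (bas i)))"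
    by (subst lin_sum[OF assms]) (simp only: lin_scale[OF assms])
  finally show ?thesis .
qed

text \<open>The bridge from the axioms, which speak of basis vectors, to arbitrary elements: the
  arguments are reduced to the basis one after another.\<close>

lemma lin_eqI:
  fixes x :: "'n::finite \<Rightarrow> 'k::field"
  assumes "lin s f" "lin s g" "\<And>i. f (bas i) = g (bas i)"
  shows "f x = g x"
  by (subst lin_expand[OF assms(1)], subst lin_expand[OF assms(2)]) (simp add: assms(3))

lemma lin_comb:
  fixes v :: "'n::finite \<Rightarrow> 'v::ab_group_add"
  assumes "module s"
  shows "lin s (\<lambda>x. \<Sum>i\<in>UNIV. s (x i) (v i))"
proof -
  interpret module s by fact
  show ?thesis
    by (rule linI[OF assms])
      (simp_all add: pw_def scale_left_distrib sum.distrib scale_sum_right)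
qed

lemma comb_bas:
  fixes v :: "'n::finite \<Rightarrow> 'v::ab_group_add"
  assumes "module s"
  shows "(\<Sum>i\<in>UNIV. s (bas j i) (v i)) = v j"
proof -
  interpret module s by fact
  have "s (bas j i) (v i) = (if i = j then v i else 0)" for i by (simp add: bas_def)
  then show ?thesis by simp
qed

lemma lin_id [lin_intro]: "lin (pw (*)) (\<lambda>x. x)"
  by (rule linI) (auto intro: lin_intro)

lemma lin_comp: "lin s f \<Longrightarrow> lin (pw (*)) g \<Longrightarrow> lin s (\<lambda>x. f (g x))"
  by (simp add: lin_def)

lemma lin_const_scale [lin_intro]:
  assumes "lin s f" shows "lin s (\<lambda>x. s c (f x))"
proof -
  interpret module s using assms by (rule lin_module)
  show ?thesis
    by (rule linI) (simp_all add: module_axioms lin_add[OF assms] lin_scale[OF assms] scale_right_distrib mult.commute)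
qed

lemma lin_scale_const [lin_intro]:
  assumes "module s" "lin (*) f" shows "lin s (\<lambda>x. s (f x) v)"
proof -
  interpret module s by fact
  show ?thesis
    by (rule linI) (simp_all add: module_axioms lin_add[OF assms(2)] lin_scale[OF assms(2)] scale_left_distrib)
qed

lemma lin_setsum [lin_intro]:
  assumes "module s" "\<And>i. lin s (\<lambda>x. f x i)"
  shows "lin s (\<lambda>x. \<Sum>i\<in>A. f x i)"
proof -
  interpret module s by fact
  show ?thesis
    by (rule linI) (simp_all add: module_axioms lin_add[OF assms(2)] lin_scale[OF assms(2)] sum.distrib scale_sum_right)
qed

lemma lin_post:
  assumes "lin s f" "module s'" "\<And>x y. g (x + y) = g x + g y" "\<And>c x. g (s c x) = s' c (g x)"
  shows "lin s' (\<lambda>x. g (f x))"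
  using assms by (auto simp: lin_def)

section \<open>Sweedler calculus\<close>

text \<open>For a bilinear f this is f(h_1, h_2), where s is the scalar multiplication of the target.
  The rules below that merely move coproducts around hold for arbitrary f, because only its values
  on basis vectors enter.\<close>
definition cop :: "('n::finite \<Rightarrow> 'n \<Rightarrow> 'n \<Rightarrow> 'k::field) \<Rightarrow> ('k \<Rightarrow> 'v \<Rightarrow> 'v) \<Rightarrow> ('n \<Rightarrow> 'k) \<Rightarrow>
    (('n \<Rightarrow> 'k) \<Rightarrow> ('n \<Rightarrow> 'k) \<Rightarrow> 'v::ab_group_add) \<Rightarrow> 'v" where
  "cop d s h f = (\<Sum>i\<in>UNIV. s (h i) (\<Sum>a\<in>UNIV. \<Sum>b\<in>UNIV. s (d i a b) (f (bas a) (bas b))))"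

lemma cop_cong: "(\<And>a b. f a b = g a b) \<Longrightarrow> cop d s h f = cop d s h g"
  by (simp add: cop_def)

lemma cop_bas: "module s \<Longrightarrow> cop d s (bas i) f = (\<Sum>a\<in>UNIV. \<Sum>b\<in>UNIV. s (d i a b) (f (bas a) (bas b)))"
  unfolding cop_def by (rule comb_bas)

lemma lin_cop0: "module s \<Longrightarrow> lin s (\<lambda>h. cop d s h f)"
  unfolding cop_def by (rule lin_comb)

lemma lin_cop1 [lin_intro]: "module s \<Longrightarrow> lin (pw (*)) g \<Longrightarrow> lin s (\<lambda>x. cop d s (g x) f)"
  using lin_comp[OF lin_cop0] .

lemma lin_cop2 [lin_intro]: "module s \<Longrightarrow> (\<And>a b. lin s (\<lambda>x. F x a b)) \<Longrightarrow> lin s (\<lambda>x. cop d s h (F x))"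
  unfolding cop_def by (intro lin_intro)

lemma cop_hom:
  assumes "module s" "module s'" "\<And>x y. g (x + y) = g x + g y" "\<And>c x. g (s c x) = s' c (g x)"
  shows "g (cop d s h f) = cop d s' h (\<lambda>a b. g (f a b))"
  unfolding cop_def by (simp add: additive_sum[of g, OF assms(3)] assms(4))

lemma cop_sum:
  assumes "module s"
  shows "(\<Sum>j\<in>J. cop d s h (f j)) = cop d s h (\<lambda>a b. \<Sum>j\<in>J. f j a b)"
proof -
  interpret module s by fact
  have "cop d s h (\<lambda>a b. F a b + G a b) = cop d s h F + cop d s h G" for F G
    by (simp add: cop_def scale_right_distrib sum.distrib)
  moreover have "cop d s h (\<lambda>a b. 0) = 0" by (simp add: cop_def)
  ultimately show ?thesis by (induction J rule: infinite_finite_induct) simp_all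
qed

lemma cop_scale:
  assumes "module s"
  shows "s c (cop d s h f) = cop d s h (\<lambda>a b. s c (f a b))"
proof -
  interpret module s by fact
  show ?thesis by (rule cop_hom[OF assms assms]) (simp_all add: scale_right_distrib mult.commute)
qed

lemma cop_swap:
  assumes "module s"
  shows "cop d s h (\<lambda>a b. cop d' s g (F a b)) = cop d' s g (\<lambda>x y. cop d s h (\<lambda>a b. F a b x y))"
proof -
  interpret module s by fact
  have "cop d s h (\<lambda>a b. cop d' s g (F a b)) =
     (\<Sum>i\<in>UNIV. \<Sum>a\<in>UNIV. \<Sum>b\<in>UNIV. s (h i * d i a b) (cop d' s g (F (bas a) (bas b))))"
    by (simp add: cop_def[of d] scale_sum_right)
  also have "\<dots> = cop d' s g (\<lambda>x y. \<Sum>i\<in>UNIV. \<Sum>a\<in>UNIV. \<Sum>b\<in>UNIV. s (h i * d i a b) (F (bas a) (bas b) x y))"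
    by (simp add: cop_scale[OF assms] cop_sum[OF assms])
  also have "\<dots> = cop d' s g (\<lambda>x y. cop d s h (\<lambda>a b. F a b x y))"
    by (simp add: cop_def[of d] scale_sum_right)
  finally show ?thesis .
qed

section \<open>The Hopf algebra axioms in Sweedler form\<close>

locale hopf =
  fixes m :: "'n::finite \<Rightarrow> 'n \<Rightarrow> 'n \<Rightarrow> 'k::field"
    and u eps :: "'n \<Rightarrow> 'k"
    and d :: "'n \<Rightarrow> 'n \<Rightarrow> 'n \<Rightarrow> 'k"
    and S :: "'n \<Rightarrow> 'n \<Rightarrow> 'k"
  assumes hopf_alg: "hopf_alg m u d eps S"
begin

abbreviation mul (infixl "\<bullet>" 70) where "x \<bullet> y \<equiv> hmul m x y"
abbreviation "D \<equiv> cop d"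

definition cou :: "('n \<Rightarrow> 'k) \<Rightarrow> 'k" where "cou x = (\<Sum>i\<in>UNIV. x i * eps i)"
definition ant :: "('n \<Rightarrow> 'k) \<Rightarrow> 'n \<Rightarrow> 'k" where "ant x = (\<Sum>i\<in>UNIV. pw (*) (x i) (S i))"

lemma lin_cou0: "lin (*) cou" unfolding cou_def by (rule lin_comb[OF module_mult])
lemma lin_ant0: "lin (pw (*)) ant" unfolding ant_def by (rule lin_comb[OF module_pw[OF module_mult]])

lemmas lin_cou [lin_intro] = lin_comp[OF lin_cou0]
  and lin_ant [lin_intro] = lin_comp[OF lin_ant0]

lemma cou_bas [simp]: "cou (bas i) = eps i" unfolding cou_def by (rule comb_bas[OF module_mult])
lemma ant_bas [simp]: "ant (bas i) = S i" unfolding ant_def by (rule comb_bas[OF module_pw[OF module_mult]])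

lemma mul_bas [simp]: "bas i \<bullet> bas j = m i j"
proof -
  have "bas i x * bas j y * m x y l = (if y = j then if x = i then m i j l else 0 else 0)" for x y l
    by (simp add: bas_def)
  then show ?thesis by (simp add: hmul_def fun_eq_iff)
qed

lemma lin_mul_left0: "lin (pw (*)) (\<lambda>x. x \<bullet> y)"
  by (rule linI) (auto intro: lin_intro simp: hmul_def fun_eq_iff pw_def algebra_simps sum.distrib sum_distrib_left)
lemma lin_mul_right0: "lin (pw (*)) (\<lambda>y. x \<bullet> y)"
  by (rule linI) (auto intro: lin_intro simp: hmul_def fun_eq_iff pw_def algebra_simps sum.distrib sum_distrib_left)
lemmas lin_mul_left [lin_intro] = lin_comp[OF lin_mul_left0]
  and lin_mul_right [lin_intro] = lin_comp[OF lin_mul_right0]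

lemma mul_assoc: "(x \<bullet> y) \<bullet> z = x \<bullet> (y \<bullet> z)"
proof (rule lin_eqI[where s="pw (*)" and x=x], (rule lin_intro)+)
  fix i show "(bas i \<bullet> y) \<bullet> z = bas i \<bullet> (y \<bullet> z)"
  proof (rule lin_eqI[where s="pw (*)" and x=y], (rule lin_intro)+)
    fix j show "(bas i \<bullet> bas j) \<bullet> z = bas i \<bullet> (bas j \<bullet> z)"
    proof (rule lin_eqI[where s="pw (*)" and x=z], (rule lin_intro)+)
      fix l
      have "m i j \<bullet> bas l = (\<Sum>p\<in>UNIV. pw (*) (m i j p) (m p l))"
        by (subst lin_expand[OF lin_mul_left0]) simp
      moreover have "bas i \<bullet> m j l = (\<Sum>p\<in>UNIV. pw (*) (m j l p) (m i p))"
        by (subst lin_expand[OF lin_mul_right0]) simp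
      ultimately show "(bas i \<bullet> bas j) \<bullet> bas l = bas i \<bullet> (bas j \<bullet> bas l)"
        using hopf_alg by (simp add: hopf_alg_def fun_eq_iff sum_fun_apply pw_def)
    qed
  qed
qed

lemma one_mul [simp]: "u \<bullet> x = x"
proof (rule lin_eqI[where s="pw (*)" and x=x], (rule lin_intro)+)
  fix i show "u \<bullet> bas i = bas i"
    using hopf_alg
    by (subst lin_expand[OF lin_mul_left0]) (simp add: hopf_alg_def fun_eq_iff sum_fun_apply pw_def bas_apply)
qed

lemma mul_one [simp]: "x \<bullet> u = x"
proof (rule lin_eqI[where s="pw (*)" and x=x], (rule lin_intro)+)
  fix i show "bas i \<bullet> u = bas i"
    using hopf_alg
    by (subst lin_expand[OF lin_mul_right0]) (simp add: hopf_alg_def fun_eq_iff sum_fun_apply pw_def bas_apply)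
qed

lemma cou_mul [simp]: "cou (x \<bullet> y) = cou x * cou y"
proof (rule lin_eqI[where x=x])
  show "lin (*) (\<lambda>x. cou (x \<bullet> y))" by (rule lin_intro)+
  show "lin (*) (\<lambda>x. cou x * cou y)" by (rule lin_intro)+
  fix i
  show "cou (bas i \<bullet> y) = cou (bas i) * cou y"
  proof (rule lin_eqI[where x=y])
    show "lin (*) (\<lambda>y. cou (bas i \<bullet> y))" by (rule lin_intro)+
    show "lin (*) (\<lambda>y. cou (bas i) * cou y)" by (rule lin_intro)+
    fix j show "cou (bas i \<bullet> bas j) = cou (bas i) * cou (bas j)"
      using hopf_alg by (simp add: hopf_alg_def cou_def[of "m i j"])
  qed
qed

lemma cou_one [simp]: "cou u = 1"
  using hopf_alg by (simp add: hopf_alg_def cou_def)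

lemma coassoc:
  assumes "module s"
  shows "D s h (\<lambda>a b. D s a (\<lambda>x y. F x y b)) = D s h (\<lambda>a b. D s b (\<lambda>x y. F a x y))"
proof (rule lin_eqI[where x=h])
  show "lin s (\<lambda>h. D s h (\<lambda>a b. D s a (\<lambda>x y. F x y b)))"
    "lin s (\<lambda>h. D s h (\<lambda>a b. D s b (\<lambda>x y. F a x y)))" by (rule lin_cop0[OF assms])+
  interpret module s by fact
  fix i
  let ?F = "\<lambda>a b c. F (bas a) (bas b) (bas c)"
  have "D s (bas i) (\<lambda>a b. D s a (\<lambda>x y. F x y b)) =
     (\<Sum>p\<in>UNIV. \<Sum>l\<in>UNIV. \<Sum>a\<in>UNIV. \<Sum>b\<in>UNIV. s (d i p l * d p a b) (?F a b l))"
    by (simp add: cop_bas assms scale_sum_right)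
  also have "\<dots> = (\<Sum>(p, l, a, b)\<in>UNIV. s (d i p l * d p a b) (?F a b l))"
    by (simp add: sum.cartesian_product UNIV_Times_UNIV split_def)
  \<comment> \<open>The axiom compares two sums over the intermediate index \<open>p\<close>, so
    \<open>p\<close> is brought to the innermost place, and moved back after the axiom has been
    applied.\<close>
  also have "\<dots> = (\<Sum>(a, b, l, p)\<in>UNIV. s (d i p l * d p a b) (?F a b l))"
    by (rule sum.reindex_bij_witness[where i="\<lambda>(a, b, l, p). (p, l, a, b)" and j="\<lambda>(p, l, a, b). (a, b, l, p)"]) auto
  also have "\<dots> = (\<Sum>a\<in>UNIV. \<Sum>b\<in>UNIV. \<Sum>l\<in>UNIV. s (\<Sum>p\<in>UNIV. d i p l * d p a b) (?F a b l))"
    by (simp add: sum.cartesian_product UNIV_Times_UNIV split_def scale_sum_left)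
  also have "\<dots> = (\<Sum>a\<in>UNIV. \<Sum>b\<in>UNIV. \<Sum>l\<in>UNIV. s (\<Sum>p\<in>UNIV. d i a p * d p b l) (?F a b l))"
    using hopf_alg by (simp add: hopf_alg_def)
  also have "\<dots> = (\<Sum>(a, b, l, p)\<in>UNIV. s (d i a p * d p b l) (?F a b l))"
    by (simp add: sum.cartesian_product UNIV_Times_UNIV split_def scale_sum_left)
  also have "\<dots> = (\<Sum>(a, p, b, l)\<in>UNIV. s (d i a p * d p b l) (?F a b l))"
    by (rule sum.reindex_bij_witness[where j="\<lambda>(a, b, l, p). (a, p, b, l)" and i="\<lambda>(a, p, b, l). (a, b, l, p)"]) auto
  also have "\<dots> = D s (bas i) (\<lambda>a b. D s b (\<lambda>x y. F a x y))"
    by (simp add: cop_bas assms scale_sum_right sum.cartesian_product UNIV_Times_UNIV split_def)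
  finally show "D s (bas i) (\<lambda>a b. D s a (\<lambda>x y. F x y b)) = D s (bas i) (\<lambda>a b. D s b (\<lambda>x y. F a x y))" .
qed

lemma counit_left:
  assumes "lin s f"
  shows "D s h (\<lambda>a b. s (cou a) (f b)) = f h"
proof (rule lin_eqI[where x=h])
  note s = lin_module[OF assms]
  interpret module s by fact
  show "lin s (\<lambda>h. D s h (\<lambda>a b. s (cou a) (f b)))" by (rule lin_cop0[OF s])
  fix i
  have "D s (bas i) (\<lambda>a b. s (cou a) (f b)) = (\<Sum>b\<in>UNIV. s (\<Sum>a\<in>UNIV. d i a b * eps a) (f (bas b)))"
    by (simp add: cop_bas s scale_sum_left) (rule sum.swap)
  also have "\<dots> = (\<Sum>b\<in>UNIV. if b = i then f (bas b) else 0)"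
    using hopf_alg by (intro sum.cong) (auto simp add: hopf_alg_def)
  finally show "D s (bas i) (\<lambda>a b. s (cou a) (f b)) = f (bas i)" by simp
qed fact

lemma counit_right:
  assumes "lin s f"
  shows "D s h (\<lambda>a b. s (cou b) (f a)) = f h"
proof (rule lin_eqI[where x=h])
  note s = lin_module[OF assms]
  interpret module s by fact
  show "lin s (\<lambda>h. D s h (\<lambda>a b. s (cou b) (f a)))" by (rule lin_cop0[OF s])
  fix i
  have "D s (bas i) (\<lambda>a b. s (cou b) (f a)) = (\<Sum>b\<in>UNIV. s (\<Sum>a\<in>UNIV. d i b a * eps a) (f (bas b)))"
    by (simp add: cop_bas s scale_sum_left)
  also have "\<dots> = (\<Sum>b\<in>UNIV. if b = i then f (bas b) else 0)"
    using hopf_alg by (intro sum.cong) (auto simp add: hopf_alg_def)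
  finally show "D s (bas i) (\<lambda>a b. s (cou b) (f a)) = f (bas i)" by simp
qed fact

lemma cop_one:
  assumes "\<And>y. lin s (\<lambda>x. F x y)" "\<And>x. lin s (F x)"
  shows "D s u F = F u u"
proof -
  note s = lin_module[OF assms(2)]
  interpret module s by fact
  have "D s u F = (\<Sum>(p, a, b)\<in>UNIV. s (u p * d p a b) (F (bas a) (bas b)))"
    by (simp add: cop_def scale_sum_right sum.cartesian_product UNIV_Times_UNIV split_def)
  also have "\<dots> = (\<Sum>(a, b, p)\<in>UNIV. s (u p * d p a b) (F (bas a) (bas b)))"
    by (rule sum.reindex_bij_witness[where j="\<lambda>(p,a,b). (a, b, p)" and i="\<lambda>(a, b, p). (p, a, b)"]) auto
  also have "\<dots> = (\<Sum>a\<in>UNIV. \<Sum>b\<in>UNIV. s (\<Sum>p\<in>UNIV. u p * d p a b) (F (bas a) (bas b)))"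
    by (simp add: scale_sum_left sum.cartesian_product UNIV_Times_UNIV split_def)
  also have "\<dots> = (\<Sum>a\<in>UNIV. \<Sum>b\<in>UNIV. s (u a * u b) (F (bas a) (bas b)))"
    using hopf_alg by (simp add: hopf_alg_def)
  also have "\<dots> = (\<Sum>a\<in>UNIV. s (u a) (F (bas a) u))"
    by (subst (2) lin_expand[OF assms(2)]) (simp add: scale_sum_right)
  finally show ?thesis by (simp add: lin_expand[OF assms(1), symmetric])
qed

text \<open>The products \<open>a \<bullet> x\<close> and \<open>b \<bullet> y\<close> of basis
  vectors are no longer basis vectors; bilinearity of \<open>F\<close> expands them, and the axiom
  on structure constants applies.\<close>

lemma cop_mul:
  assumes "\<And>y. lin s (\<lambda>x. F x y)" "\<And>x. lin s (F x)"
  shows "D s (g \<bullet> h) F = D s g (\<lambda>a b. D s h (\<lambda>x y. F (a \<bullet> x) (b \<bullet> y)))"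
proof -
  note s = lin_module[OF assms(2)]
  interpret module s by fact
  note F = lin_comp[OF assms(1)] lin_comp[OF assms(2)]
  note L = lin_intro F s
  show ?thesis
  proof (rule lin_eqI[where x=g])
    show "lin s (\<lambda>g. D s (g \<bullet> h) F)" by (rule L)+
    show "lin s (\<lambda>g. D s g (\<lambda>a b. D s h (\<lambda>x y. F (a \<bullet> x) (b \<bullet> y))))" by (rule lin_cop0[OF s])
    fix i
    show "D s (bas i \<bullet> h) F = D s (bas i) (\<lambda>a b. D s h (\<lambda>x y. F (a \<bullet> x) (b \<bullet> y)))"
    proof (rule lin_eqI[where x=h])
      show "lin s (\<lambda>h. D s (bas i \<bullet> h) F)" by (rule L)+
      show "lin s (\<lambda>h. D s (bas i) (\<lambda>a b. D s h (\<lambda>x y. F (a \<bullet> x) (b \<bullet> y))))"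
        by (rule L)+
      fix j
      let ?F = "\<lambda>a b. F (bas a) (bas b)"
      have FF: "F (m a1 a2) (m b1 b2) = (\<Sum>a\<in>UNIV. \<Sum>b\<in>UNIV. s (m a1 a2 a * m b1 b2 b) (?F a b))" for a1 a2 b1 b2
      proof -
        have "F (m a1 a2) (m b1 b2) = (\<Sum>a\<in>UNIV. s (m a1 a2 a) (F (bas a) (m b1 b2)))"
          by (rule lin_expand[OF assms(1)])
        also have "\<dots> = (\<Sum>a\<in>UNIV. s (m a1 a2 a) (\<Sum>b\<in>UNIV. s (m b1 b2 b) (?F a b)))"
          by (subst lin_expand[OF assms(2)]) simp
        finally show ?thesis by (simp add: scale_sum_right)
      qed
      have "D s (bas i \<bullet> bas j) F = (\<Sum>(p, a, b)\<in>UNIV. s (m i j p * d p a b) (?F a b))"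
        by (simp add: cop_def scale_sum_right sum.cartesian_product UNIV_Times_UNIV split_def)
      also have "\<dots> = (\<Sum>(a, b, p)\<in>UNIV. s (m i j p * d p a b) (?F a b))"
        by (rule sum.reindex_bij_witness[where j="\<lambda>(p,a,b). (a, b, p)" and i="\<lambda>(a, b, p). (p, a, b)"]) auto
      also have "\<dots> = (\<Sum>a\<in>UNIV. \<Sum>b\<in>UNIV. s (\<Sum>p\<in>UNIV. m i j p * d p a b) (?F a b))"
        by (simp add: scale_sum_left sum.cartesian_product UNIV_Times_UNIV split_def)
      also have "\<dots> = (\<Sum>a\<in>UNIV. \<Sum>b\<in>UNIV. s (\<Sum>a1\<in>UNIV. \<Sum>b1\<in>UNIV. \<Sum>a2\<in>UNIV. \<Sum>b2\<in>UNIV. d i a1 b1 * d j a2 b2 * m a1 a2 a * m b1 b2 b) (?F a b))"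
        using hopf_alg by (simp add: hopf_alg_def)
      also have "\<dots> = (\<Sum>(a, b, a1, b1, a2, b2)\<in>UNIV. s (d i a1 b1 * d j a2 b2 * m a1 a2 a * m b1 b2 b) (?F a b))"
        by (simp add: scale_sum_left sum.cartesian_product UNIV_Times_UNIV split_def)
      also have "\<dots> = (\<Sum>(a1, b1, a2, b2, a, b)\<in>UNIV. s (d i a1 b1 * d j a2 b2 * m a1 a2 a * m b1 b2 b) (?F a b))"
        by (rule sum.reindex_bij_witness[where j="\<lambda>(a, b, a1, b1, a2, b2). (a1, b1, a2, b2, a, b)"
             and i="\<lambda>(a1, b1, a2, b2, a, b). (a, b, a1, b1, a2, b2)"]) auto
      also have "\<dots> = (\<Sum>a1\<in>UNIV. \<Sum>b1\<in>UNIV. s (d i a1 b1) (\<Sum>a2\<in>UNIV. \<Sum>b2\<in>UNIV. s (d j a2 b2) (F (m a1 a2) (m b1 b2))))"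
        unfolding FF by (simp add: scale_sum_right sum.cartesian_product UNIV_Times_UNIV split_def mult.assoc)
      finally show "D s (bas i \<bullet> bas j) F = D s (bas i) (\<lambda>a b. D s (bas j) (\<lambda>x y. F (a \<bullet> x) (b \<bullet> y)))"
        by (simp add: cop_bas s)
    qed
  qed
qed

lemma antipode_left:
  assumes "lin s f"
  shows "D s h (\<lambda>a b. f (ant a \<bullet> b)) = s (cou h) (f u)"
proof -
  note s = lin_module[OF assms] and hs = module_pw[OF module_mult]
  have "D (pw (*)) h (\<lambda>a b. ant a \<bullet> b) = pw (*) (cou h) u"
  proof (rule lin_eqI[where x=h])
    show "lin (pw (*)) (\<lambda>h. D (pw (*)) h (\<lambda>a b. ant a \<bullet> b))" by (rule lin_cop0[OF hs])
    show "lin (pw (*)) (\<lambda>h. pw (*) (cou h) u)" by (rule lin_intro)+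
    fix i
    have *: "S a \<bullet> bas b = (\<Sum>c\<in>UNIV. pw (*) (S a c) (m c b))" for a b
      by (subst lin_expand[OF lin_mul_left0]) simp
    show "D (pw (*)) (bas i) (\<lambda>a b. ant a \<bullet> b) = pw (*) (cou (bas i)) u"
      using hopf_alg
      by (simp add: cop_bas hs * hopf_alg_def fun_eq_iff pw_def sum_fun_apply sum_distrib_left mult.assoc)
  qed
  then have "f (D (pw (*)) h (\<lambda>a b. ant a \<bullet> b)) = s (cou h) (f u)"
    by (simp add: lin_scale[OF assms])
  then show ?thesis
    by (subst (asm) cop_hom[OF hs s]) (simp_all add: lin_add[OF assms] lin_scale[OF assms])
qed

lemma antipode_right:
  assumes "lin s f"
  shows "D s h (\<lambda>a b. f (a \<bullet> ant b)) = s (cou h) (f u)"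
proof -
  note s = lin_module[OF assms] and hs = module_pw[OF module_mult]
  have "D (pw (*)) h (\<lambda>a b. a \<bullet> ant b) = pw (*) (cou h) u"
  proof (rule lin_eqI[where x=h])
    show "lin (pw (*)) (\<lambda>h. D (pw (*)) h (\<lambda>a b. a \<bullet> ant b))" by (rule lin_cop0[OF hs])
    show "lin (pw (*)) (\<lambda>h. pw (*) (cou h) u)" by (rule lin_intro)+
    fix i
    have *: "bas a \<bullet> S b = (\<Sum>c\<in>UNIV. pw (*) (S b c) (m a c))" for a b
      by (subst lin_expand[OF lin_mul_right0]) simp
    show "D (pw (*)) (bas i) (\<lambda>a b. a \<bullet> ant b) = pw (*) (cou (bas i)) u"
      using hopf_alg
      by (simp add: cop_bas hs * hopf_alg_def fun_eq_iff pw_def sum_fun_apply sum_distrib_left mult.assoc)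
  qed
  then have "f (D (pw (*)) h (\<lambda>a b. a \<bullet> ant b)) = s (cou h) (f u)"
    by (simp add: lin_scale[OF assms])
  then show ?thesis
    by (subst (asm) cop_hom[OF hs s]) (simp_all add: lin_add[OF assms] lin_scale[OF assms])
qed

section \<open>The antipode reverses products and coproducts\<close>

lemmas module_H = module_pw[OF module_mult]

text \<open>Uniqueness of convolution inverses in Hom(H \<otimes> H, H): S(xy) is a left inverse of
  the multiplication and S(y) S(x) a right inverse, so both arise from S(x_1 y_1) (x_2 y_2) (S(y_3)
  S(x_3)) by cancelling one pair.\<close>

lemma ant_mul: "ant (x \<bullet> y) = ant y \<bullet> ant x"
proof -
  let ?s = "pw (*) :: 'k \<Rightarrow> ('n \<Rightarrow> 'k) \<Rightarrow> 'n \<Rightarrow> 'k"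
  let ?E = "D ?s"
  note hs = module_H
  \<comment> \<open>The right inverse property read backwards: two counits are expanded into the
    factor x_2 y_2 S(y_3) S(x_3).\<close>
  have pad: "?s (cou x') (?s (cou y') z) = ?E x' (\<lambda>x2 x3. ?E y' (\<lambda>y2 y3. (z \<bullet> (x2 \<bullet> y2)) \<bullet> (ant y3 \<bullet> ant x3)))" for x' y' z
  proof -
    have "?E x' (\<lambda>x2 x3. ?E y' (\<lambda>y2 y3. (z \<bullet> (x2 \<bullet> y2)) \<bullet> (ant y3 \<bullet> ant x3)))
       = ?E x' (\<lambda>x2 x3. ?E y' (\<lambda>y2 y3. z \<bullet> (x2 \<bullet> ((y2 \<bullet> ant y3) \<bullet> ant x3))))"
      by (simp only: mul_assoc)
    also have "\<dots> = ?E x' (\<lambda>x2 x3. ?s (cou y') (z \<bullet> (x2 \<bullet> (u \<bullet> ant x3))))"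
      by (rule cop_cong, rule antipode_right, (rule lin_intro)+)
    also have "\<dots> = ?E x' (\<lambda>x2 x3. ?s (cou y') (z \<bullet> (x2 \<bullet> ant x3)))" by simp
    also have "\<dots> = ?s (cou x') (?s (cou y') (z \<bullet> u))"
      by (rule antipode_right, (rule lin_intro)+)
    finally show ?thesis by simp
  qed
  have "ant (x \<bullet> y) = ?E x (\<lambda>x1 x'. ?s (cou x') (ant (x1 \<bullet> y)))"
    by (rule counit_right[symmetric], (rule lin_intro)+)
  also have "\<dots> = ?E x (\<lambda>x1 x'. ?E y (\<lambda>y1 y'. ?s (cou y') (?s (cou x') (ant (x1 \<bullet> y1)))))"
    by (rule cop_cong, rule counit_right[symmetric], (rule lin_intro)+)
  also have "\<dots> = ?E x (\<lambda>x1 x'. ?E y (\<lambda>y1 y'. ?s (cou x') (?s (cou y') (ant (x1 \<bullet> y1)))))"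
    by (simp add: pw_def mult.left_commute)
  also have "\<dots> = ?E x (\<lambda>x1 x'. ?E y (\<lambda>y1 y'. ?E x' (\<lambda>x2 x3. ?E y' (\<lambda>y2 y3.
      (ant (x1 \<bullet> y1) \<bullet> (x2 \<bullet> y2)) \<bullet> (ant y3 \<bullet> ant x3)))))"
    unfolding pad ..
  also have "\<dots> = ?E x (\<lambda>x1 x'. ?E x' (\<lambda>x2 x3. ?E y (\<lambda>y1 y'. ?E y' (\<lambda>y2 y3.
      (ant (x1 \<bullet> y1) \<bullet> (x2 \<bullet> y2)) \<bullet> (ant y3 \<bullet> ant x3)))))"
    by (rule cop_cong, rule cop_swap[OF hs])
  also have "\<dots> = ?E x (\<lambda>x1 x'. ?E x' (\<lambda>x2 x3. ?E y (\<lambda>y' y3. ?E y' (\<lambda>y1 y2.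
      (ant (x1 \<bullet> y1) \<bullet> (x2 \<bullet> y2)) \<bullet> (ant y3 \<bullet> ant x3)))))"
    by (rule cop_cong, rule cop_cong, rule coassoc[OF hs, symmetric])
  also have "\<dots> = ?E x (\<lambda>x' x3. ?E x' (\<lambda>x1 x2. ?E y (\<lambda>y' y3. ?E y' (\<lambda>y1 y2.
      (ant (x1 \<bullet> y1) \<bullet> (x2 \<bullet> y2)) \<bullet> (ant y3 \<bullet> ant x3)))))"
    by (rule coassoc[OF hs, symmetric])
  also have "\<dots> = ?E x (\<lambda>x' x3. ?E y (\<lambda>y' y3. ?E x' (\<lambda>x1 x2. ?E y' (\<lambda>y1 y2.
      (ant (x1 \<bullet> y1) \<bullet> (x2 \<bullet> y2)) \<bullet> (ant y3 \<bullet> ant x3)))))"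
    by (rule cop_cong, rule cop_swap[OF hs])
  also have "\<dots> = ?E x (\<lambda>x' x3. ?E y (\<lambda>y' y3. ?E (x' \<bullet> y') (\<lambda>a b. (ant a \<bullet> b) \<bullet> (ant y3 \<bullet> ant x3))))"
    by ((rule cop_cong)+, rule cop_mul[symmetric], (rule lin_intro)+)
  also have "\<dots> = ?E x (\<lambda>x' x3. ?E y (\<lambda>y' y3. ?s (cou (x' \<bullet> y')) (u \<bullet> (ant y3 \<bullet> ant x3))))"
    by ((rule cop_cong)+, rule antipode_left, (rule lin_intro)+)
  also have "\<dots> = ?E x (\<lambda>x' x3. ?E y (\<lambda>y' y3. ?s (cou y') (?s (cou x') (ant y3 \<bullet> ant x3))))"
    by (simp add: pw_def mult_ac)
  also have "\<dots> = ?E x (\<lambda>x' x3. ?s (cou x') (ant y \<bullet> ant x3))"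
    by (rule cop_cong, rule counit_left, (rule lin_intro)+)
  also have "\<dots> = ant y \<bullet> ant x"
    by (rule counit_left, (rule lin_intro)+)
  finally show ?thesis .
qed

lemma ant_one [simp]: "ant u = u"
proof -
  have "ant u \<bullet> u = D (pw (*)) u (\<lambda>a b. ant a \<bullet> b)"
    by (rule cop_one[symmetric], (rule lin_intro)+)
  also have "\<dots> = pw (*) (cou u) u"
    by (rule antipode_left, (rule lin_intro)+)
  finally show ?thesis by (simp add: pw_def)
qed

lemma cou_ant [simp]: "cou (ant x) = cou x"
proof -
  have "D (*) x (\<lambda>a b. cou (ant a \<bullet> b)) = cou x * cou u"
    by (rule antipode_left) (rule lin_cou0)
  moreover have "D (*) x (\<lambda>a b. cou b * cou (ant a)) = cou (ant x)"
    by (rule counit_right, (rule lin_intro)+)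
  ultimately show ?thesis by (simp add: mult.commute)
qed

text \<open>The dual argument, with convolution inverses of Delta in Hom(H, H \<otimes> H):
  Delta(S(h)) inverts from the left and S(h_2) \<otimes> S(h_1) from the right.\<close>

lemma cop_ant:
  assumes F: "\<And>y. lin s (\<lambda>x. F x y)" "\<And>x. lin s (F x)"
  shows "D s (ant h) F = D s h (\<lambda>a b. F (ant b) (ant a))"
proof -
  note s = lin_module[OF assms(2)]
  note L = lin_intro lin_comp[OF F(1)] lin_comp[OF F(2)] s
  \<comment> \<open>\<open>Q y a b\<close> evaluates \<open>F\<close> at a \<otimes> b after right
    multiplication by S(y_2) \<otimes> S(y_1), the candidate for the inverse.\<close>
  define Q where "Q y a b = D s y (\<lambda>h4 h5. F (a \<bullet> ant h5) (b \<bullet> ant h4))" for y a b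
  have pad: "s (cou h') (F p q) = D s h' (\<lambda>k y. D s k (\<lambda>h2 h3. Q y (p \<bullet> h2) (q \<bullet> h3)))" for h' p q
  proof -
    have "D s h' (\<lambda>k y. D s k (\<lambda>h2 h3. Q y (p \<bullet> h2) (q \<bullet> h3))) =
       D s h' (\<lambda>h2 z. D s z (\<lambda>h3 y. Q y (p \<bullet> h2) (q \<bullet> h3)))"
      by (rule coassoc[OF s])
    also have "\<dots> = D s h' (\<lambda>h2 z. D s z (\<lambda>w h5. D s w (\<lambda>h3 h4. F ((p \<bullet> h2) \<bullet> ant h5) ((q \<bullet> h3) \<bullet> ant h4))))"
      unfolding Q_def by (rule cop_cong, rule coassoc[OF s, symmetric])
    also have "\<dots> = D s h' (\<lambda>h2 z. D s z (\<lambda>w h5. D s w (\<lambda>h3 h4. F ((p \<bullet> h2) \<bullet> ant h5) (q \<bullet> (h3 \<bullet> ant h4)))))"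
      by (simp only: mul_assoc)
    also have "\<dots> = D s h' (\<lambda>h2 z. D s z (\<lambda>w h5. s (cou w) (F ((p \<bullet> h2) \<bullet> ant h5) (q \<bullet> u))))"
      by ((rule cop_cong)+, rule antipode_right, (rule L)+)
    also have "\<dots> = D s h' (\<lambda>h2 z. F ((p \<bullet> h2) \<bullet> ant z) (q \<bullet> u))"
      by (rule cop_cong, rule counit_left, (rule L)+)
    also have "\<dots> = D s h' (\<lambda>h2 z. F (p \<bullet> (h2 \<bullet> ant z)) q)"
      by (simp add: mul_assoc)
    also have "\<dots> = s (cou h') (F (p \<bullet> u) q)"
      by (rule antipode_right, (rule L)+)
    finally show ?thesis by simp
  qed
  have Q: "lin s (\<lambda>x. Q y (g x) b)" "lin s (\<lambda>x. Q y a (g x))" "lin s (\<lambda>x. Q (g x) a b)"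
    if "lin (pw (*)) g" for y a b and g :: "('n \<Rightarrow> 'k) \<Rightarrow> 'n \<Rightarrow> 'k"
    unfolding Q_def by (rule L that)+
  have "D s (ant h) F = D s h (\<lambda>h1 h'. s (cou h') (D s (ant h1) F))"
    by (rule counit_right[symmetric], (rule L)+)
  also have "\<dots> = D s h (\<lambda>h1 h'. D s (ant h1) (\<lambda>p q. s (cou h') (F p q)))"
    by (rule cop_cong, rule cop_scale[OF s])
  also have "\<dots> = D s h (\<lambda>h1 h'. D s (ant h1) (\<lambda>p q. D s h' (\<lambda>k y. D s k (\<lambda>h2 h3. Q y (p \<bullet> h2) (q \<bullet> h3)))))"
    unfolding pad ..
  also have "\<dots> = D s h (\<lambda>h1 h'. D s h' (\<lambda>k y. D s (ant h1) (\<lambda>p q. D s k (\<lambda>h2 h3. Q y (p \<bullet> h2) (q \<bullet> h3)))))"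
    by (rule cop_cong, rule cop_swap[OF s])
  also have "\<dots> = D s h (\<lambda>h1 h'. D s h' (\<lambda>k y. D s (ant h1 \<bullet> k) (Q y)))"
    by ((rule cop_cong)+, rule cop_mul[symmetric], (rule Q lin_intro)+)
  also have "\<dots> = D s h (\<lambda>g y. D s g (\<lambda>h1 k. D s (ant h1 \<bullet> k) (Q y)))"
    by (rule coassoc[OF s, symmetric])
  also have "\<dots> = D s h (\<lambda>g y. s (cou g) (D s u (Q y)))"
    by (rule cop_cong, rule antipode_left, (rule L)+)
  also have "\<dots> = D s u (Q h)"
    by (rule counit_left, (rule L Q)+)
  also have "\<dots> = Q h u u" by (rule cop_one, (rule Q lin_intro)+)
  finally show ?thesis by (simp add: Q_def)
qed

text \<open>This is tr(BA) = tr(AB) with coefficients: A sends x to x_1 \<otimes> \<open>M\<close>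
  x_2 and B sends y to y_1 \<otimes> y_2. The trace is taken over the second legs, while
  \<open>g\<close> collects the first ones.\<close>

lemma trace_cyclic:
  assumes "module s"
  shows "(\<Sum>i\<in>UNIV. D s (bas i) (\<lambda>x1 x'. D s (M x') (\<lambda>y1 y2. s (y2 i) (g y1 x1)))) =
    (\<Sum>i\<in>UNIV. D s (bas i) (\<lambda>y1 y2. D s y2 (\<lambda>x1 x'. s (M x' i) (g y1 x1))))"
proof -
  interpret module s by fact
  have b: "(\<Sum>b\<in>UNIV. c b * bas b i) = c i" for c :: "'n \<Rightarrow> 'k" and i
    by (simp add: bas_apply if_distrib cong: if_cong)
  have "(\<Sum>i\<in>UNIV. D s (bas i) (\<lambda>x1 x'. D s (M x') (\<lambda>y1 y2. s (y2 i) (g y1 x1)))) =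
     (\<Sum>i\<in>UNIV. \<Sum>p\<in>UNIV. \<Sum>q\<in>UNIV. \<Sum>r\<in>UNIV. \<Sum>\<alpha>\<in>UNIV. s (d i p q * M (bas q) r * d r \<alpha> i) (g (bas \<alpha>) (bas p)))"
    by (simp add: cop_bas[OF assms]) (simp add: cop_def scale_sum_right scale_sum_left[symmetric] b mult.assoc sum_distrib_left[symmetric])
  also have "\<dots> = (\<Sum>(i, p, q, r, \<alpha>)\<in>UNIV. s (d i p q * M (bas q) r * d r \<alpha> i) (g (bas \<alpha>) (bas p)))"
    by (simp add: sum.cartesian_product UNIV_Times_UNIV split_def)
  also have "\<dots> = (\<Sum>(r, \<alpha>, i, p, q)\<in>UNIV. s (d r \<alpha> i * d i p q * M (bas q) r) (g (bas \<alpha>) (bas p)))"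
    by (rule sum.reindex_bij_witness[where j="\<lambda>(i, p, q, r, \<alpha>). (r, \<alpha>, i, p, q)" and i="\<lambda>(r, \<alpha>, i, p, q). (i, p, q, r, \<alpha>)"])
      (auto simp: mult.commute mult.left_commute)
  also have "\<dots> = (\<Sum>i\<in>UNIV. D s (bas i) (\<lambda>y1 y2. D s y2 (\<lambda>x1 x'. s (M x' i) (g y1 x1))))"
    by (simp add: cop_bas[OF assms] scale_sum_right sum.cartesian_product UNIV_Times_UNIV split_def mult.assoc)
  finally show ?thesis .
qed

text \<open>The trace of x |-> h S(S(x)). The square of the antipode is what makes it an integral of the
  dual, for an arbitrary finite dimensional Hopf algebra; it may vanish in general, but it takes
  the value 1 on an integral t with eps(t) = 1.\<close>
definition lam :: "('n \<Rightarrow> 'k) \<Rightarrow> 'k" where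
  "lam h = (\<Sum>i\<in>UNIV. (h \<bullet> ant (ant (bas i))) i)"

lemma lin_lam0: "lin (*) lam"
  by (rule linI) (simp_all add: lam_def module_mult lin_add[OF lin_mul_left0] lin_scale[OF lin_mul_left0] sum.distrib sum_distrib_left pw_apply)

lemmas lin_lam [lin_intro] = lin_comp[OF lin_lam0]

text \<open>Write T(h, x) = h S(S(x)). Comultiplying T(h, x_2) and multiplying its first leg by
  S(x_1) from the right gives h_1 \<otimes> T(h_2, x). Under the trace the two coproducts may be
  rotated; the first legs then meet as y_1 S(y_2) and become a counit.\<close>

lemma lam_left:
  assumes f: "lin s f"
  shows "D s h (\<lambda>a b. s (lam b) (f a)) = s (lam h) (f u)"
proof -
  note s = lin_module[OF f]
  interpret module s by fact
  define T where "T y x = y \<bullet> ant (ant x)" for y x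
  have lT: "lin s (\<lambda>x. s (T y (g x) i) v)" "lin s (\<lambda>x. s (g x i) v)"
    if "lin (pw (*)) g" for y i v and g :: "('n \<Rightarrow> 'k) \<Rightarrow> 'n \<Rightarrow> 'k"
  proof -
    have *: "lin (*) (\<lambda>x. G x i)" if "lin (pw (*)) G" for G :: "('n \<Rightarrow> 'k) \<Rightarrow> 'n \<Rightarrow> 'k"
      using that by (simp add: lin_def pw_def module_mult)
    show "lin s (\<lambda>x. s (T y (g x) i) v)" "lin s (\<lambda>x. s (g x i) v)"
      unfolding T_def by (rule lin_scale_const[OF s] * lin_intro that)+
  qed
  note L = lin_const_scale lT lin_comp[OF f] lin_intro s
  \<comment> \<open>The surplus factor is S(S(x_2)) S(x_1) = S(x_1 S(x_2)), hence a counit. The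
    square of the antipode in \<open>lam\<close> serves to produce it.\<close>
  have one: "D s h (\<lambda>a b. s (T b x i) (f a)) =
      D s x (\<lambda>x1 x'. D s (T h x') (\<lambda>y1 y2. s (y2 i) (f (y1 \<bullet> ant x1))))" for i x
  proof -
    have "D s x (\<lambda>x1 x'. D s (T h x') (\<lambda>y1 y2. s (y2 i) (f (y1 \<bullet> ant x1)))) =
       D s x (\<lambda>x1 x'. D s h (\<lambda>a b. D s (ant (ant x')) (\<lambda>p q. s ((b \<bullet> q) i) (f ((a \<bullet> p) \<bullet> ant x1)))))"
      unfolding T_def by (rule cop_cong, rule cop_mul, (rule L)+)
    also have "\<dots> = D s x (\<lambda>x1 x'. D s h (\<lambda>a b. D s (ant x') (\<lambda>p q. s ((b \<bullet> ant p) i) (f ((a \<bullet> ant q) \<bullet> ant x1)))))"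
      by ((rule cop_cong)+, rule cop_ant, (rule L)+)
    also have "\<dots> = D s x (\<lambda>x1 x'. D s h (\<lambda>a b. D s x' (\<lambda>x2 x3. s ((b \<bullet> ant (ant x3)) i) (f ((a \<bullet> ant (ant x2)) \<bullet> ant x1)))))"
      by ((rule cop_cong)+, rule cop_ant, (rule L)+)
    also have "\<dots> = D s h (\<lambda>a b. D s x (\<lambda>x1 x'. D s x' (\<lambda>x2 x3. s ((b \<bullet> ant (ant x3)) i) (f ((a \<bullet> ant (ant x2)) \<bullet> ant x1)))))"
      by (rule cop_swap[OF s])
    also have "\<dots> = D s h (\<lambda>a b. D s x (\<lambda>w x3. D s w (\<lambda>x1 x2. s (T b x3 i) (f (a \<bullet> ant (x1 \<bullet> ant x2))))))"
      unfolding T_def ant_mul mul_assoc by (rule cop_cong, rule coassoc[OF s, symmetric])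
    also have "\<dots> = D s h (\<lambda>a b. D s x (\<lambda>w x3. s (cou w) (s (T b x3 i) (f (a \<bullet> ant u)))))"
      by ((rule cop_cong)+, rule antipode_right, (rule L)+)
    also have "\<dots> = D s h (\<lambda>a b. s (T b x i) (f (a \<bullet> ant u)))"
      by (rule cop_cong, rule counit_left, (rule L)+)
    finally show ?thesis by simp
  qed
  have "D s h (\<lambda>a b. s (lam b) (f a)) = (\<Sum>i\<in>UNIV. D s h (\<lambda>a b. s (T b (bas i) i) (f a)))"
    by (simp add: cop_sum[OF s] lam_def T_def scale_sum_left)
  also have "\<dots> = (\<Sum>i\<in>UNIV. D s (bas i) (\<lambda>x1 x'. D s (T h x') (\<lambda>y1 y2. s (y2 i) (f (y1 \<bullet> ant x1)))))"
    unfolding one ..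
  also have "\<dots> = (\<Sum>i\<in>UNIV. D s (bas i) (\<lambda>y1 y2. D s y2 (\<lambda>x1 x'. s (T h x' i) (f (y1 \<bullet> ant x1)))))"
    by (rule trace_cyclic[OF s])
  also have "\<dots> = (\<Sum>i\<in>UNIV. s (T h (bas i) i) (f u))"
  proof (rule sum.cong[OF refl])
    fix i
    have "D s (bas i) (\<lambda>y1 y2. D s y2 (\<lambda>x1 x'. s (T h x' i) (f (y1 \<bullet> ant x1)))) =
        D s (bas i) (\<lambda>w x'. D s w (\<lambda>y1 x1. s (T h x' i) (f (y1 \<bullet> ant x1))))"
      by (rule coassoc[OF s, symmetric])
    also have "\<dots> = D s (bas i) (\<lambda>w x'. s (cou w) (s (T h x' i) (f u)))"
      by (rule cop_cong, rule antipode_right, (rule L)+)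
    also have "\<dots> = s (T h (bas i) i) (f u)"
      by (rule counit_left, (rule L)+)
    finally show "D s (bas i) (\<lambda>y1 y2. D s y2 (\<lambda>x1 x'. s (T h x' i) (f (y1 \<bullet> ant x1)))) = s (T h (bas i) i) (f u)" .
  qed
  finally show ?thesis by (simp add: lam_def T_def scale_sum_left)
qed

end

section \<open>Integrals\<close>

lemma left_ideal_iff_submodule:
  fixes R :: "('r::ab_group_add, 'm) ring_scheme"
  assumes "ring R" and R: "carrier R = UNIV" "\<zero>\<^bsub>R\<^esub> = 0" "\<And>x y. x \<oplus>\<^bsub>R\<^esub> y = x + y"
  shows "left_ideal R L \<longleftrightarrow> submodule_of R (monoid.mult R) L"
proof -
  interpret ring R by fact
  have uminus: "inv\<^bsub>add_monoid R\<^esub> x = - x" for x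
    unfolding a_inv_def[symmetric] by (rule minus_equality) (simp_all add: R)
  have "additive_subgroup L R \<longleftrightarrow> 0 \<in> L \<and> (\<forall>x\<in>L. \<forall>y\<in>L. x + y \<in> L) \<and> (\<forall>x\<in>L. - x \<in> L)"
  proof
    assume "additive_subgroup L R"
    then interpret subgroup L "add_monoid R" by (rule additive_subgroup.a_subgroup)
    show "0 \<in> L \<and> (\<forall>x\<in>L. \<forall>y\<in>L. x + y \<in> L) \<and> (\<forall>x\<in>L. - x \<in> L)"
      using one_closed m_closed m_inv_closed unfolding uminus by (simp add: R)
  next
    assume L: "0 \<in> L \<and> (\<forall>x\<in>L. \<forall>y\<in>L. x + y \<in> L) \<and> (\<forall>x\<in>L. - x \<in> L)"
    show "additive_subgroup L R"
    proof (rule additive_subgroupI, rule add.subgroupI)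
      show "L \<subseteq> carrier R" "L \<noteq> {}" using L by (auto simp: R)
      show "\<ominus>\<^bsub>R\<^esub> x \<in> L" if "x \<in> L" for x using L that by (simp add: uminus a_inv_def)
      show "x \<oplus>\<^bsub>R\<^esub> y \<in> L" if "x \<in> L" "y \<in> L" for x y using L that by (simp add: R)
    qed
  qed
  then show ?thesis by (simp add: left_ideal_def submodule_of_def R conj_ac)
qed

section \<open>Consequences of a normalized integral and a unimodular dual\<close>

locale integral_hopf = hopf m u eps d S
  for m :: "'n::finite \<Rightarrow> 'n \<Rightarrow> 'n \<Rightarrow> 'k::field" and u eps d S +
  fixes t :: "'n \<Rightarrow> 'k"
  assumes left_integral: "h \<bullet> t = pw (*) (cou h) t"
    and cou_integral [simp]: "cou t = 1"
    and unimod: "dual_unimodular u d"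
begin

text \<open>The counit of h_1 is absorbed into t as h_1 t, and in S(h_1 t) h_2 = S(t) S(h_1) h_2 the
  antipode cancels.\<close>

lemma right_integral_ant: "ant t \<bullet> h = pw (*) (cou h) (ant t)"
proof -
  note s = module_H
  let ?E = "D (pw (*) :: 'k \<Rightarrow> ('n \<Rightarrow> 'k) \<Rightarrow> _)"
  have "ant t \<bullet> h = ?E h (\<lambda>a h'. pw (*) (cou a) (ant t \<bullet> h'))"
    by (rule counit_left[symmetric], (rule lin_intro)+)
  also have "\<dots> = ?E h (\<lambda>a h'. ant (a \<bullet> t) \<bullet> h')"
    by (simp add: left_integral lin_scale[OF lin_ant0] lin_scale[OF lin_mul_left0])
  also have "\<dots> = ?E h (\<lambda>a b. ant t \<bullet> (ant a \<bullet> b))"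
    by (simp add: ant_mul mul_assoc)
  also have "\<dots> = pw (*) (cou h) (ant t \<bullet> u)"
    by (rule antipode_left, (rule lin_intro)+)
  finally show ?thesis by simp
qed

text \<open>The product S(t) t equals S(t) because S(t) is a right integral, and t because t is a
  left one; both have counit 1.\<close>

lemma ant_integral [simp]: "ant t = t"
proof -
  have "ant t = ant t \<bullet> t" by (simp add: right_integral_ant pw_def)
  also have "\<dots> = t" by (simp add: left_integral pw_def)
  finally show ?thesis .
qed

lemmas right_integral = right_integral_ant[simplified]

text \<open>As t is a right integral, x \<mapsto> t S(S(x)) is the rank one map x \<mapsto> eps(x)
  t, whose trace is eps(t).\<close>

lemma lam_integral [simp]: "lam t = 1"
proof -
  have "lam t = (\<Sum>i\<in>UNIV. eps i * t i)"
    unfolding lam_def right_integral by (simp add: pw_apply del: ant_bas)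
  also have "\<dots> = cou t" by (simp add: cou_def mult.commute)
  finally show ?thesis by simp
qed

text \<open>Unimodularity of the dual enters here: by \<open>lam_left\<close> the functional is a
  left integral of the dual, and it is therefore also a right one.\<close>

lemma lam_right:
  assumes f: "lin s f"
  shows "D s h (\<lambda>a b. s (lam a) (f b)) = s (lam h) (f u)"
proof -
  note s = lin_module[OF f]
  let ?L = "\<lambda>i. lam (bas i)"
  have "dual_left_integral u d ?L"
    unfolding dual_left_integral_def
  proof (intro allI)
    fix g :: "'n \<Rightarrow> 'k" and i
    have "lin (*) (\<lambda>a :: 'n \<Rightarrow> 'k. \<Sum>l\<in>UNIV. a l * g l)" by (rule lin_comb[OF module_mult])
    note * = lam_left[OF this, of "bas i"]
    have "(\<Sum>l\<in>UNIV. bas a l * g l) = g a" for a by (rule comb_bas[OF module_mult])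
    with *
    show "(\<Sum>a\<in>UNIV. \<Sum>b\<in>UNIV. d i a b * g a * ?L b) = (\<Sum>l\<in>UNIV. u l * g l) * ?L i"
      by (simp add: cop_bas[OF module_mult]) (simp add: mult_ac)
  qed
  then have "dual_right_integral u d ?L"
    using unimod by (auto simp: dual_unimodular_def)
  \<comment> \<open>The test functionals are the coordinates; running through all of them turns the
    scalar identity into an identity of vectors.\<close>
  then have *: "(\<Sum>a\<in>UNIV. \<Sum>b\<in>UNIV. d i a b * ?L a * bas l b) = (\<Sum>j\<in>UNIV. u j * bas l j) * ?L i" for i l
    by (simp add: dual_right_integral_def)
  have **: "D (pw (*)) h (\<lambda>a b. pw (*) (lam a) b) = pw (*) (lam h) u"
  proof (rule lin_eqI[where x=h and s = "pw (*)"])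
    show "lin (pw (*)) (\<lambda>h. D (pw (*)) h (\<lambda>a b. pw (*) (lam a) b))" by (rule lin_cop0[OF module_H])
    show "lin (pw (*)) (\<lambda>h. pw (*) (lam h) u)" by (rule lin_intro)+
    fix i
    show "D (pw (*)) (bas i) (\<lambda>a b. pw (*) (lam a) b) = pw (*) (lam (bas i)) u"
      using *[of i]
      by (simp add: cop_bas[OF module_H] fun_eq_iff pw_apply sum_fun_apply bas_apply if_distrib mult_ac cong: if_cong)
  qed
  have "s (lam h) (f u) = f (D (pw (*)) h (\<lambda>a b. pw (*) (lam a) b))"
    unfolding ** by (simp add: lin_scale[OF f])
  also have "\<dots> = D s h (\<lambda>a b. f (pw (*) (lam a) b))"
    by (rule cop_hom[OF module_H s, of f, OF lin_add[OF f] lin_scale[OF f]])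
  finally show ?thesis by (simp add: lin_scale[OF f])
qed

text \<open>Read from right to left: \<open>lam_left\<close> spreads lam(g_2 x) over the coproduct
  of g_2 x, and the prefixed S(g_1) cancels the leg of g that appears.\<close>

lemma lam_left_mul:
  assumes f: "lin s f"
  shows "D s x (\<lambda>a b. s (lam (g \<bullet> b)) (f a)) = D s g (\<lambda>g1 g2. s (lam (g2 \<bullet> x)) (f (ant g1)))"
proof -
  note s = lin_module[OF f]
  note L = lin_const_scale lin_comp[OF f] lin_intro s
  have "D s g (\<lambda>g1 g2. s (lam (g2 \<bullet> x)) (f (ant g1))) =
      D s g (\<lambda>g1 g2. s (lam (g2 \<bullet> x)) (f (ant g1 \<bullet> u)))" by simp
  also have "\<dots> = D s g (\<lambda>g1 g2. D s (g2 \<bullet> x) (\<lambda>p q. s (lam q) (f (ant g1 \<bullet> p))))"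
    by (rule cop_cong, rule lam_left[symmetric], (rule L)+)
  also have "\<dots> = D s g (\<lambda>g1 g2. D s g2 (\<lambda>g3 g4. D s x (\<lambda>a b. s (lam (g4 \<bullet> b)) (f (ant g1 \<bullet> (g3 \<bullet> a))))))"
    by (rule cop_cong, rule cop_mul, (rule L)+)
  also have "\<dots> = D s g (\<lambda>k g4. D s k (\<lambda>g1 g3. D s x (\<lambda>a b. s (lam (g4 \<bullet> b)) (f ((ant g1 \<bullet> g3) \<bullet> a)))))"
    unfolding mul_assoc by (rule coassoc[OF s, symmetric])
  also have "\<dots> = D s g (\<lambda>k g4. s (cou k) (D s x (\<lambda>a b. s (lam (g4 \<bullet> b)) (f (u \<bullet> a)))))"
    by (rule cop_cong, rule antipode_left, (rule L)+)
  also have "\<dots> = D s x (\<lambda>a b. s (lam (g \<bullet> b)) (f (u \<bullet> a)))"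
    by (rule counit_left, (rule L)+)
  finally show ?thesis by simp
qed

text \<open>The mirror formula, based on \<open>lam_right\<close>: S is applied to the second leg of
  the coproduct of g_1 x, and S(g_2) g_3 cancels, so that only the antipode of \<open>b\<close>
  remains.\<close>

lemma lam_right_mul:
  assumes f: "lin s f"
  shows "D s x (\<lambda>a b. s (lam (g \<bullet> a)) (f (ant b))) = D s g (\<lambda>g1 g2. s (lam (g1 \<bullet> x)) (f g2))"
proof -
  note s = lin_module[OF f]
  note L = lin_const_scale lin_comp[OF f] lin_intro s
  have "D s g (\<lambda>g1 g2. s (lam (g1 \<bullet> x)) (f g2)) =
      D s g (\<lambda>g1 g2. s (lam (g1 \<bullet> x)) (f (ant u \<bullet> g2)))" by simp
  also have "\<dots> = D s g (\<lambda>g1 g2. D s (g1 \<bullet> x) (\<lambda>p q. s (lam p) (f (ant q \<bullet> g2))))"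
    by (rule cop_cong, rule lam_right[symmetric], (rule L)+)
  also have "\<dots> = D s g (\<lambda>g1 g2. D s g1 (\<lambda>g3 g4. D s x (\<lambda>a b. s (lam (g3 \<bullet> a)) (f (ant (g4 \<bullet> b) \<bullet> g2)))))"
    by (rule cop_cong, rule cop_mul, (rule L)+)
  also have "\<dots> = D s g (\<lambda>g3 k. D s k (\<lambda>g4 g2. D s x (\<lambda>a b. s (lam (g3 \<bullet> a)) (f (ant b \<bullet> (ant g4 \<bullet> g2))))))"
    unfolding mul_assoc ant_mul by (rule coassoc[OF s])
  also have "\<dots> = D s g (\<lambda>g3 k. s (cou k) (D s x (\<lambda>a b. s (lam (g3 \<bullet> a)) (f (ant b \<bullet> u)))))"
    by (rule cop_cong, rule antipode_left, (rule L)+)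
  also have "\<dots> = D s x (\<lambda>a b. s (lam (g \<bullet> a)) (f (ant b \<bullet> u)))"
    by (rule counit_right, (rule L)+)
  finally show ?thesis by simp
qed

text \<open>The identity t_1 S(t_3) \<otimes> t_2 = 1 \<otimes> t, tested against the functionals lam(h _).\<close>
lemma integral_twisted:
  assumes f: "lin s f"
  shows "D s t (\<lambda>t1 z. D s z (\<lambda>t2 t3. s (lam (h \<bullet> t2)) (f (t1 \<bullet> ant t3)))) = s (cou h) (f u)"
proof -
  note s = lin_module[OF f]
  interpret module s by fact
  note L = lin_const_scale lin_comp[OF f] lin_intro s
  \<comment> \<open>Right invariance trades S(t_3) for h_2; afterwards left invariance trades t_1
    for an antipode of a leg of h.\<close>
  have "D s t (\<lambda>t1 z. D s z (\<lambda>t2 t3. s (lam (h \<bullet> t2)) (f (t1 \<bullet> ant t3)))) =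
      D s t (\<lambda>t1 z. D s h (\<lambda>h1 h2. s (lam (h1 \<bullet> z)) (f (t1 \<bullet> h2))))"
    by (rule cop_cong, rule lam_right_mul, (rule L)+)
  also have "\<dots> = D s h (\<lambda>h1 h2. D s t (\<lambda>t1 z. s (lam (h1 \<bullet> z)) (f (t1 \<bullet> h2))))"
    by (rule cop_swap[OF s])
  also have "\<dots> = D s h (\<lambda>h1 h2. D s h1 (\<lambda>p q. s (lam (q \<bullet> t)) (f (ant p \<bullet> h2))))"
    by (rule cop_cong, rule lam_left_mul, (rule L)+)
  \<comment> \<open>Since t is a left integral, lam(q t) = eps(q) lam(t), and lam(t) = 1.\<close>
  also have "\<dots> = D s h (\<lambda>h1 h2. D s h1 (\<lambda>p q. s (cou q) (f (ant p \<bullet> h2))))"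
    by (simp add: left_integral lin_scale[OF lin_lam0])
  also have "\<dots> = D s h (\<lambda>h1 h2. f (ant h1 \<bullet> h2))"
    by (rule cop_cong, rule counit_right, (rule L)+)
  also have "\<dots> = s (cou h) (f u)" by (rule antipode_left) (rule f)
  finally show ?thesis .
qed

text \<open>With S(h_2) h_3 inserted after S(t_2), the legs h_1 and h_2 multiply the coproduct of t
  as a coproduct. The left integral turns them into a counit and leaves h at the far right.\<close>

lemma casimir:
  assumes F: "\<And>y. lin s (\<lambda>x. F x y)" "\<And>x. lin s (F x)"
  shows "D s t (\<lambda>a b. F (h \<bullet> a) (ant b)) = D s t (\<lambda>a b. F a (ant b \<bullet> h))"
proof -
  note s = lin_module[OF F(2)]
  note L = lin_const_scale lin_comp[OF F(1)] lin_comp[OF F(2)] lin_intro s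
  have "D s t (\<lambda>a b. F (h \<bullet> a) (ant b)) = D s t (\<lambda>a b. D s h (\<lambda>h1 k. s (cou k) (F (h1 \<bullet> a) (ant b \<bullet> u))))"
    by (subst counit_right, (rule L)+) simp
  also have "\<dots> = D s t (\<lambda>a b. D s h (\<lambda>h1 k. D s k (\<lambda>h2 h3. F (h1 \<bullet> a) (ant b \<bullet> (ant h2 \<bullet> h3)))))"
    by (rule cop_cong, rule cop_cong, rule antipode_left[symmetric], (rule L)+)
  also have "\<dots> = D s h (\<lambda>h1 k. D s t (\<lambda>a b. D s k (\<lambda>h2 h3. F (h1 \<bullet> a) (ant b \<bullet> (ant h2 \<bullet> h3)))))"
    by (rule cop_swap[OF s])
  also have "\<dots> = D s h (\<lambda>h1 k. D s k (\<lambda>h2 h3. D s t (\<lambda>a b. F (h1 \<bullet> a) (ant (h2 \<bullet> b) \<bullet> h3))))"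
    unfolding ant_mul mul_assoc by (rule cop_cong, rule cop_swap[OF s])
  also have "\<dots> = D s h (\<lambda>k h3. D s k (\<lambda>h1 h2. D s t (\<lambda>a b. F (h1 \<bullet> a) (ant (h2 \<bullet> b) \<bullet> h3))))"
    by (rule coassoc[OF s, symmetric])
  also have "\<dots> = D s h (\<lambda>k h3. D s (k \<bullet> t) (\<lambda>a b. F a (ant b \<bullet> h3)))"
    by (rule cop_cong, rule cop_mul[symmetric], (rule L)+)
  also have "\<dots> = D s h (\<lambda>k h3. s (cou k) (D s t (\<lambda>a b. F a (ant b \<bullet> h3))))"
    by (simp add: left_integral lin_scale[OF lin_cop0[OF s]])
  also have "\<dots> = D s t (\<lambda>a b. F a (ant b \<bullet> h))"
    by (rule counit_left, (rule L)+)
  finally show ?thesis .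
qed

text \<open>The mirror argument: h_1 S(h_2) is inserted before S(t_1), and the right integral
  absorbs h_2 and h_3.\<close>

lemma casimir_left_antipode:
  assumes F: "\<And>y. lin s (\<lambda>x. F x y)" "\<And>x. lin s (F x)"
  shows "D s t (\<lambda>a b. F (ant a) (b \<bullet> h)) = D s t (\<lambda>a b. F (h \<bullet> ant a) b)"
proof -
  note s = lin_module[OF F(2)]
  note L = lin_const_scale lin_comp[OF F(1)] lin_comp[OF F(2)] lin_intro s
  have "D s t (\<lambda>a b. F (ant a) (b \<bullet> h)) = D s t (\<lambda>a b. D s h (\<lambda>k h3. s (cou k) (F (u \<bullet> ant a) (b \<bullet> h3))))"
    by (subst counit_left, (rule L)+) simp
  also have "\<dots> = D s t (\<lambda>a b. D s h (\<lambda>k h3. D s k (\<lambda>h1 h2. F ((h1 \<bullet> ant h2) \<bullet> ant a) (b \<bullet> h3))))"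
    by (rule cop_cong, rule cop_cong, rule antipode_right[symmetric], (rule L)+)
  also have "\<dots> = D s h (\<lambda>k h3. D s t (\<lambda>a b. D s k (\<lambda>h1 h2. F ((h1 \<bullet> ant h2) \<bullet> ant a) (b \<bullet> h3))))"
    by (rule cop_swap[OF s])
  also have "\<dots> = D s h (\<lambda>k h3. D s k (\<lambda>h1 h2. D s t (\<lambda>a b. F (h1 \<bullet> ant (a \<bullet> h2)) (b \<bullet> h3))))"
    unfolding ant_mul mul_assoc by (rule cop_cong, rule cop_swap[OF s])
  also have "\<dots> = D s h (\<lambda>h1 k. D s k (\<lambda>h2 h3. D s t (\<lambda>a b. F (h1 \<bullet> ant (a \<bullet> h2)) (b \<bullet> h3))))"
    by (rule coassoc[OF s])
  also have "\<dots> = D s h (\<lambda>h1 k. D s t (\<lambda>a b. D s k (\<lambda>h2 h3. F (h1 \<bullet> ant (a \<bullet> h2)) (b \<bullet> h3))))"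
    by (rule cop_cong, rule cop_swap[OF s])
  also have "\<dots> = D s h (\<lambda>h1 k. D s (t \<bullet> k) (\<lambda>a b. F (h1 \<bullet> ant a) b))"
    by (rule cop_cong, rule cop_mul[symmetric], (rule L)+)
  also have "\<dots> = D s h (\<lambda>h1 k. s (cou k) (D s t (\<lambda>a b. F (h1 \<bullet> ant a) b)))"
    by (simp add: right_integral lin_scale[OF lin_cop0[OF s]])
  also have "\<dots> = D s t (\<lambda>a b. F (h \<bullet> ant a) b)"
    by (rule counit_right, (rule L)+)
  finally show ?thesis .
qed

text \<open>The dual basis property of the form lam(yx). The Casimir identity moves x out of
  \<open>lam\<close> to the left of S(t_1); what is left is invariance of \<open>lam\<close> and
  lam(t) = 1.\<close>

lemma integral_expand:
  assumes f: "lin s f"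
  shows "D s t (\<lambda>a b. s (lam (b \<bullet> x)) (f (ant a))) = f x"
proof -
  note s = lin_module[OF f]
  interpret module s by fact
  note L = lin_const_scale lin_comp[OF f] lin_intro s
  have "D s t (\<lambda>a b. s (lam (b \<bullet> x)) (f (ant a))) = D s t (\<lambda>a b. s (lam b) (f (x \<bullet> ant a)))"
    by (rule casimir_left_antipode, (rule L)+)
  also have "\<dots> = s (lam t) (f (x \<bullet> ant u))" by (rule lam_left, (rule L)+)
  finally show ?thesis by simp
qed

text \<open>\<open>integral_expand\<close> writes x as a linear combination of values of the
  antipode.\<close>

lemma ant_surj: "\<exists>y. x = ant y"
proof -
  have "x = D (pw (*)) t (\<lambda>a b. pw (*) (lam (b \<bullet> x)) (ant a))"
    by (rule integral_expand[where f = "\<lambda>x. x", symmetric]) (rule lin_id)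
  also have "\<dots> = D (pw (*)) t (\<lambda>a b. ant (pw (*) (lam (b \<bullet> x)) a))"
    by (simp only: lin_scale[OF lin_ant0])
  also have "\<dots> = ant (D (pw (*)) t (\<lambda>a b. pw (*) (lam (b \<bullet> x)) a))"
    by (rule cop_hom[where g = ant, OF module_H module_H lin_add[OF lin_ant0] lin_scale[OF lin_ant0], symmetric])
  finally show ?thesis by blast
qed

text \<open>As lam is non-degenerate, the tested identity holds without lam.\<close>
lemma integral_cyclic:
  assumes F: "\<And>y. lin s (\<lambda>x. F x y)" "\<And>x. lin s (F x)"
  shows "D s t (\<lambda>t1 z. D s z (\<lambda>t2 t3. F (t1 \<bullet> ant t3) t2)) = F u t"
proof -
  note s = lin_module[OF F(2)]
  note L = lin_const_scale lin_comp[OF F(1)] lin_comp[OF F(2)] lin_intro s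
  \<comment> \<open>The leg t_2 is expanded by \<open>integral_expand\<close> with a second copy of
    t, whose legs are \<open>a\<close> and \<open>b\<close>; then \<open>integral_twisted\<close>
    applies with \<open>b\<close> in place of h.\<close>
  have "D s t (\<lambda>t1 z. D s z (\<lambda>t2 t3. F (t1 \<bullet> ant t3) t2)) =
     D s t (\<lambda>t1 z. D s z (\<lambda>t2 t3. D s t (\<lambda>a b. s (lam (b \<bullet> t2)) (F (t1 \<bullet> ant t3) (ant a)))))"
    by (rule cop_cong, rule cop_cong, rule integral_expand[symmetric], (rule L)+)
  also have "\<dots> = D s t (\<lambda>t1 z. D s t (\<lambda>a b. D s z (\<lambda>t2 t3. s (lam (b \<bullet> t2)) (F (t1 \<bullet> ant t3) (ant a)))))"
    by (rule cop_cong, rule cop_swap[OF s])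
  also have "\<dots> = D s t (\<lambda>a b. D s t (\<lambda>t1 z. D s z (\<lambda>t2 t3. s (lam (b \<bullet> t2)) (F (t1 \<bullet> ant t3) (ant a)))))"
    by (rule cop_swap[OF s])
  also have "\<dots> = D s t (\<lambda>a b. s (cou b) (F u (ant a)))"
    by (rule cop_cong, rule integral_twisted, (rule L)+)
  also have "\<dots> = F u (ant t)" by (rule counit_right, (rule L)+)
  finally show ?thesis by simp
qed

end

text \<open>The kernel of eps is a left ideal, and eps is injective on a complementary left ideal L.
  The component t of 1 in L has counit 1, and h t - eps(h) t lies in L with counit 0.\<close>

lemma (in hopf) integral_exists:
  assumes "semisimple_artinian (H_ring m u)"
  obtains t where "\<And>h. h \<bullet> t = pw (*) (cou h) t" and "cou t = 1"
proof -
  define R where "R = H_ring m u"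
  have R: "carrier R = UNIV" "\<And>x y. x \<otimes>\<^bsub>R\<^esub> y = x \<bullet> y" "\<And>x y. x \<oplus>\<^bsub>R\<^esub> y = x + y" "\<zero>\<^bsub>R\<^esub> = 0"
    by (simp_all add: R_def H_ring_def)
  have ideal: "left_ideal R L \<longleftrightarrow> submodule_of R (\<bullet>) L" for L
    using left_ideal_iff_submodule[of R L] assms
    by (simp add: semisimple_artinian_def R_def[symmetric] R) (simp add: R_def H_ring_def)
  note cou_add = lin_add[OF lin_cou0] and cou_scale = lin_scale[OF lin_cou0]
  have cou_minus: "cou (- x) = - cou x" for x
    by (simp add: cou_def sum_negf)
  let ?K = "{x. cou x = 0}"
  have "left_ideal R ?K"
    unfolding ideal submodule_of_def by (auto simp: cou_add cou_minus cou_def[of 0])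
  then obtain L where L: "left_ideal R L" "?K \<inter> L = {0}" "\<And>x. \<exists>a\<in>?K. \<exists>b\<in>L. x = a + b"
    using assms unfolding semisimple_artinian_def R_def[symmetric] by (auto simp: R)
  from L(3) obtain a t where t: "cou a = 0" "t \<in> L" "u = a + t" by blast
  have cou_t: "cou t = 1"
    using t by (metis add_0 cou_add cou_one)
  have "h \<bullet> t = pw (*) (cou h) t" for h
  proof -
    \<comment> \<open>A left ideal is closed under ring multiplication, so the scalar -eps(h) is
      applied by multiplying with a multiple of the unit.\<close>
    have "h \<bullet> t + pw (*) (- cou h) u \<bullet> t \<in> L"
      using L(1) t(2) unfolding ideal submodule_of_def by (simp add: R)
    then have "h \<bullet> t + pw (*) (- cou h) t \<in> L"
      by (simp add: lin_scale[OF lin_mul_left0])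
    moreover have "cou (h \<bullet> t + pw (*) (- cou h) t) = 0"
      by (simp add: cou_add cou_scale cou_t)
    ultimately have "h \<bullet> t + pw (*) (- cou h) t = 0" using L(2) by blast
    then show ?thesis by (simp add: fun_eq_iff pw_apply add_eq_0_iff2)
  qed
  with cou_t show thesis by (rule that[rotated])
qed

section \<open>The L-R-smash product\<close>

locale bimodule_hopf = hopf m u eps d S
  for m :: "'n::finite \<Rightarrow> 'n \<Rightarrow> 'n \<Rightarrow> 'k::field" and u eps d S +
  fixes sc :: "'k \<Rightarrow> 'a::ring_1 \<Rightarrow> 'a"
    and lact :: "'n \<Rightarrow> 'a \<Rightarrow> 'a" and ract :: "'a \<Rightarrow> 'n \<Rightarrow> 'a"
  assumes bimod: "bimodule_algebra m u d eps sc lact ract"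
begin

lemma k_alg: "k_algebra sc"
  using bimod by (simp add: bimodule_algebra_def)

sublocale sc: module sc
proof -
  note k = k_alg[unfolded k_algebra_def]
  show "module sc"
    by (rule module.intro)
      (simp_all only: k[THEN conjunct1] k[THEN conjunct2, THEN conjunct1]
        k[THEN conjunct2, THEN conjunct2, THEN conjunct1]
        k[THEN conjunct2, THEN conjunct2, THEN conjunct2, THEN conjunct1])
qed

lemmas module_A [lin_intro] = sc.module_axioms
lemmas module_R [lin_intro] = module_pw[OF module_A]
sublocale R: module "pw sc" by (rule module_R)

lemma sc_mult_left: "sc c (x * y) = sc c x * y" and sc_mult_right: "sc c (x * y) = x * sc c y"
  using k_alg[unfolded k_algebra_def, THEN conjunct2, THEN conjunct2, THEN conjunct2, THEN conjunct2, rule_format, of c x y]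
  by (rule conjunct1, rule conjunct2)

definition la :: "('n \<Rightarrow> 'k) \<Rightarrow> 'a \<Rightarrow> 'a" where "la h x = (\<Sum>i\<in>UNIV. sc (h i) (lact i x))"
definition ra :: "'a \<Rightarrow> ('n \<Rightarrow> 'k) \<Rightarrow> 'a" where "ra x h = (\<Sum>i\<in>UNIV. sc (h i) (ract x i))"
text \<open>The elementary tensor a \<natural> h.\<close>

definition pure :: "'a \<Rightarrow> ('n \<Rightarrow> 'k) \<Rightarrow> 'n \<Rightarrow> 'a" where "pure a h = (\<lambda>i. sc (h i) a)"
abbreviation smul (infixl "\<natural>" 70) where "smul \<equiv> smash_mult m d sc lact ract"

section \<open>The bimodule algebra laws for arbitrary elements of H\<close>

lemma act_axioms:
  shows "lact i (x + y) = lact i x + lact i y" "lact i (sc c x) = sc c (lact i x)"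
    "ract (x + y) i = ract x i + ract y i" "ract (sc c x) i = sc c (ract x i)"
    "lact i (lact j x) = (\<Sum>l\<in>UNIV. sc (m i j l) (lact l x))"
    "ract (ract x i) j = (\<Sum>l\<in>UNIV. sc (m i j l) (ract x l))"
    "lact i (ract x j) = ract (lact i x) j"
    "lact i (x * y) = (\<Sum>a\<in>UNIV. \<Sum>b\<in>UNIV. sc (d i a b) (lact a x * lact b y))"
    "ract (x * y) i = (\<Sum>a\<in>UNIV. \<Sum>b\<in>UNIV. sc (d i a b) (ract x a * ract y b))"
    "lact i 1 = sc (eps i) 1" "ract 1 i = sc (eps i) 1"
  using bimod unfolding bimodule_algebra_def by - (elim conjE, simp only:)+

lemma la_add: "la h (x + y) = la h x + la h y"
  and la_scale: "la h (sc c x) = sc c (la h x)"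
  and ra_add: "ra (x + y) h = ra x h + ra y h"
  and ra_scale: "ra (sc c x) h = sc c (ra x h)"
  by (simp_all add: la_def ra_def act_axioms sc.scale_right_distrib sum.distrib sc.scale_sum_right mult.commute)

lemma la_bas [simp]: "la (bas i) x = lact i x" and ra_bas [simp]: "ra x (bas i) = ract x i"
  unfolding la_def ra_def by (rule comb_bas[OF module_A])+

lemma lin_la0: "lin sc (\<lambda>h. la h x)" and lin_ra0: "lin sc (\<lambda>h. ra x h)"
  unfolding la_def ra_def by (rule lin_comb[OF module_A])+

lemma pure_add: "pure (a + b) h = pure a h + pure b h"
  and pure_scale: "pure (sc c a) h = pw sc c (pure a h)"
  by (simp_all add: pure_def fun_eq_iff pw_apply sc.scale_right_distrib mult.commute)

lemma la_zero [simp]: "la h 0 = 0" and ra_zero [simp]: "ra 0 h = 0" and pure_zero [simp]: "pure 0 h = 0"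
  using la_add[of h 0 0] ra_add[of 0 0 h] pure_add[of 0 0 h] by simp_all

lemma lin_pure0: "lin (pw sc) (pure a)"
  by (rule linI[OF module_R]) (simp_all add: pure_def fun_eq_iff pw_apply sc.scale_left_distrib)

lemmas [lin_intro] = lin_comp[OF lin_la0] lin_comp[OF lin_ra0] lin_comp[OF lin_pure0]

lemma lin_la2 [lin_intro]: "lin sc f \<Longrightarrow> lin sc (\<lambda>x. la h (f x))"
  by (rule lin_post[where g = "la h", OF _ module_A la_add la_scale])

lemma lin_ra2 [lin_intro]: "lin sc f \<Longrightarrow> lin sc (\<lambda>x. ra (f x) h)"
  by (rule lin_post[where g = "\<lambda>x. ra x h", OF _ module_A ra_add ra_scale])

lemma lin_pure2 [lin_intro]: "lin sc f \<Longrightarrow> lin (pw sc) (\<lambda>x. pure (f x) h)"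
  by (rule lin_post[where g = "\<lambda>x. pure x h", OF _ module_R pure_add pure_scale])

lemma lin_times_left [lin_intro]: "lin sc f \<Longrightarrow> lin sc (\<lambda>x. f x * b)"
  by (rule lin_post[where g = "\<lambda>x. x * b", OF _ module_A distrib_right sc_mult_left[symmetric]])

lemma lin_times_right [lin_intro]: "lin sc f \<Longrightarrow> lin sc (\<lambda>x. b * f x)"
  by (rule lin_post[where g = "\<lambda>x. b * x", OF _ module_A distrib_left sc_mult_right[symmetric]])

lemma la_mul: "la (g \<bullet> h) x = la g (la h x)"
proof (rule lin_eqI[where x=g and s=sc], (rule lin_intro)+)
  fix i show "la (bas i \<bullet> h) x = la (bas i) (la h x)"
  proof (rule lin_eqI[where x=h and s=sc], (rule lin_intro)+)
    fix j show "la (bas i \<bullet> bas j) x = la (bas i) (la (bas j) x)"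
      by (simp add: act_axioms) (simp add: la_def)
  qed
qed

lemma ra_mul: "ra x (g \<bullet> h) = ra (ra x g) h"
proof (rule lin_eqI[where x=g and s=sc], (rule lin_intro)+)
  fix i show "ra x (bas i \<bullet> h) = ra (ra x (bas i)) h"
  proof (rule lin_eqI[where x=h and s=sc], (rule lin_intro)+)
    fix j show "ra x (bas i \<bullet> bas j) = ra (ra x (bas i)) (bas j)"
      by (simp add: act_axioms) (simp add: ra_def)
  qed
qed

lemma la_ra: "la g (ra x h) = ra (la g x) h"
proof (rule lin_eqI[where x=g and s=sc], (rule lin_intro)+)
  fix i show "la (bas i) (ra x h) = ra (la (bas i) x) h"
    by (rule lin_eqI[where x=h and s=sc], (rule lin_intro)+) (simp add: act_axioms)
qed

lemma la_one [simp]: "la u x = x" and ra_one [simp]: "ra x u = x"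
  using bimod by (simp_all add: bimodule_algebra_def la_def ra_def)

lemma la_unit: "la h 1 = sc (cou h) 1"
  by (rule lin_eqI[where x=h and s=sc], (rule lin_intro)+) (simp add: act_axioms)

lemma ra_unit: "ra 1 h = sc (cou h) 1"
  by (rule lin_eqI[where x=h and s=sc], (rule lin_intro)+) (simp add: act_axioms)

lemma la_times: "la h (x * y) = D sc h (\<lambda>a b. la a x * la b y)"
  by (rule lin_eqI[where x=h and s=sc], (rule lin_intro)+) (simp add: act_axioms cop_bas[OF module_A])

lemma ra_times: "ra (x * y) h = D sc h (\<lambda>a b. ra x a * ra y b)"
  by (rule lin_eqI[where x=h and s=sc], (rule lin_intro)+) (simp add: act_axioms cop_bas[OF module_A])

section \<open>Products of elementary tensors, associativity and unit\<close>

lemma pure_expand: "x = (\<Sum>i\<in>UNIV. pure (x i) (bas i))"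
  by (simp add: fun_eq_iff sum_fun_apply pure_def bas_apply if_distrib cong: if_cong)
    (simp add: if_distribR cong: if_cong)

lemma smash_mult_expand:
  "x \<natural> y = (\<Sum>i\<in>UNIV. \<Sum>j\<in>UNIV. D (pw sc) (bas i) (\<lambda>a b. D (pw sc) (bas j) (\<lambda>c e.
     pure (ra (x i) e * la a (y j)) (b \<bullet> c))))"
  by (simp add: smash_mult_def fun_eq_iff cop_bas[OF module_R] sum_fun_apply pw_apply pure_def sc.scale_sum_right mult.assoc)

lemma smash_add_left: "(x + x') \<natural> y = x \<natural> y + x' \<natural> y"
  and smash_add_right: "x \<natural> (y + y') = x \<natural> y + x \<natural> y'"
  by (simp_all add: smash_mult_def fun_eq_iff act_axioms distrib_right distrib_left sc.scale_right_distrib sum.distrib)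

lemma smash_scale_left: "pw sc c x \<natural> y = pw sc c (x \<natural> y)"
  by (simp add: smash_mult_def fun_eq_iff pw_apply act_axioms sc_mult_left[symmetric] sc.scale_sum_right mult_ac)

lemma smash_scale_right: "x \<natural> pw sc c y = pw sc c (x \<natural> y)"
  by (simp add: smash_mult_def fun_eq_iff pw_apply act_axioms sc_mult_right[symmetric] sc.scale_sum_right mult_ac)

lemmas smash_sum_left = additive_sum[of "\<lambda>x. x \<natural> y" for y, OF smash_add_left]
lemmas smash_sum_right = additive_sum[of "\<lambda>y. x \<natural> y" for x, OF smash_add_right]

lemmas smash_cop_left = cop_hom[of "pw sc" "pw sc" "\<lambda>x. x \<natural> y" for y, OF module_R module_R smash_add_left smash_scale_left]
lemmas smash_cop_right = cop_hom[of "pw sc" "pw sc" "\<lambda>y. x \<natural> y" for x, OF module_R module_R smash_add_right smash_scale_right]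

lemma lin_smash_left [lin_intro]: "lin (pw sc) f \<Longrightarrow> lin (pw sc) (\<lambda>x. f x \<natural> y)"
  by (rule lin_post[where g = "\<lambda>x. x \<natural> y", OF _ module_R smash_add_left smash_scale_left])

lemma lin_smash_right [lin_intro]: "lin (pw sc) f \<Longrightarrow> lin (pw sc) (\<lambda>x. y \<natural> f x)"
  by (rule lin_post[where g = "\<lambda>x. y \<natural> x", OF _ module_R smash_add_right smash_scale_right])

lemma smash_pure:
  "pure a h \<natural> pure b g = D (pw sc) h (\<lambda>h1 h2. D (pw sc) g (\<lambda>g1 g2. pure (ra a g2 * la h1 b) (h2 \<bullet> g1)))"
proof (rule lin_eqI[where x=h and s="pw sc"], (rule lin_intro)+)
  fix i
  show "pure a (bas i) \<natural> pure b g = D (pw sc) (bas i) (\<lambda>h1 h2. D (pw sc) g (\<lambda>g1 g2. pure (ra a g2 * la h1 b) (h2 \<bullet> g1)))"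
  proof (rule lin_eqI[where x=g and s="pw sc"], (rule lin_intro)+)
    fix j
    let ?D = "\<lambda>i j a b. D (pw sc) (bas i) (\<lambda>h1 h2. D (pw sc) (bas j) (\<lambda>g1 g2. pure (ra a g2 * la h1 b) (h2 \<bullet> g1)))"
    have "?D x y (pure a (bas i) x) (pure b (bas j) y) = (if y = j then if x = i then ?D i j a b else 0 else 0)" for x y
    proof -
      have "pure a (bas i) x = (if x = i then a else 0)" "pure b (bas j) y = (if y = j then b else 0)"
        by (simp_all add: pure_def bas_def)
      then show ?thesis by (simp add: cop_bas[OF module_R] del: la_bas ra_bas)
    qed
    then show "pure a (bas i) \<natural> pure b (bas j) = ?D i j a b"
      by (simp add: smash_mult_expand[of "pure a (bas i)"])
  qed
qed

text \<open>Both bracketings reduce to one expression \<open>N\<close> in the threefold coproducts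
  of h, g and k. What remains is to nest the coproducts in the same order by \<open>cop_swap\<close>
  and \<open>coassoc\<close>.\<close>

lemma smash_assoc_pure:
  "pure a h \<natural> pure b g \<natural> pure c k = pure a h \<natural> (pure b g \<natural> pure c k)"
proof -
  let ?E = "D (pw sc)"
  define N where "N h1 h2 h3 g1 g2 g3 k1 k2 k3 =
    pure ((ra (ra a g3) k2 * ra (la h1 b) k3) * la (h2 \<bullet> g1) c) ((h3 \<bullet> g2) \<bullet> k1)" for h1 h2 h3 g1 g2 g3 k1 k2 k3
  note s = module_R
  have "pure a h \<natural> pure b g \<natural> pure c k =
    ?E h (\<lambda>h1 h'. ?E g (\<lambda>g' g3. ?E (h' \<bullet> g') (\<lambda>p q. ?E k (\<lambda>k1 k'.
      pure (ra (ra a g3 * la h1 b) k' * la p c) (q \<bullet> k1)))))"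
    unfolding smash_pure[of a] smash_cop_left smash_pure[of _ _ c] ..
  also have "\<dots> = ?E h (\<lambda>h1 h'. ?E g (\<lambda>g' g3. ?E h' (\<lambda>h2 h3. ?E g' (\<lambda>g1 g2. ?E k (\<lambda>k1 k'.
      pure (ra (ra a g3 * la h1 b) k' * la (h2 \<bullet> g1) c) ((h3 \<bullet> g2) \<bullet> k1))))))"
    by (rule cop_cong, rule cop_cong, rule cop_mul, (rule lin_intro)+)
  also have "\<dots> = ?E h (\<lambda>h1 h'. ?E g (\<lambda>g' g3. ?E h' (\<lambda>h2 h3. ?E g' (\<lambda>g1 g2. ?E k (\<lambda>k1 k'. ?E k' (\<lambda>k2 k3.
      N h1 h2 h3 g1 g2 g3 k1 k2 k3))))))"
    unfolding ra_times N_def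
    by ((rule cop_cong)+, rule cop_hom[where g = "\<lambda>x. pure (x * y) z" for y z, OF module_A module_R])
       (simp_all add: distrib_right pure_add pure_scale sc_mult_left[symmetric])
  also have "\<dots> = ?E h (\<lambda>h1 h'. ?E h' (\<lambda>h2 h3. ?E g (\<lambda>g' g3. ?E g' (\<lambda>g1 g2. ?E k (\<lambda>k1 k'. ?E k' (\<lambda>k2 k3.
      N h1 h2 h3 g1 g2 g3 k1 k2 k3))))))"
    by (rule cop_cong, rule cop_swap[OF s])
  also have "\<dots> = ?E h (\<lambda>h1 h'. ?E h' (\<lambda>h2 h3. ?E g (\<lambda>g1 g'. ?E g' (\<lambda>g2 g3. ?E k (\<lambda>k1 k'. ?E k' (\<lambda>k2 k3.
      N h1 h2 h3 g1 g2 g3 k1 k2 k3))))))"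
    by (rule cop_cong, rule cop_cong, rule coassoc[OF s])
  finally have L: "pure a h \<natural> pure b g \<natural> pure c k = \<dots>" .
  have "pure a h \<natural> (pure b g \<natural> pure c k) =
    ?E g (\<lambda>g1 g'. ?E k (\<lambda>k' k3. ?E h (\<lambda>h' h3. ?E (g' \<bullet> k') (\<lambda>p q.
      pure (ra a q * la h' (ra b k3 * la g1 c)) (h3 \<bullet> p)))))"
    unfolding smash_pure[of b] smash_cop_right smash_pure[of a] ..
  also have "\<dots> = ?E g (\<lambda>g1 g'. ?E k (\<lambda>k' k3. ?E h (\<lambda>h' h3. ?E g' (\<lambda>g2 g3. ?E k' (\<lambda>k1 k2.
      pure (ra a (g3 \<bullet> k2) * la h' (ra b k3 * la g1 c)) (h3 \<bullet> (g2 \<bullet> k1)))))))"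
    by (rule cop_cong, rule cop_cong, rule cop_cong, rule cop_mul, (rule lin_intro)+)
  also have "\<dots> = ?E g (\<lambda>g1 g'. ?E k (\<lambda>k' k3. ?E h (\<lambda>h' h3. ?E g' (\<lambda>g2 g3. ?E k' (\<lambda>k1 k2. ?E h' (\<lambda>h1 h2.
      pure (ra a (g3 \<bullet> k2) * (la h1 (ra b k3) * la h2 (la g1 c))) (h3 \<bullet> (g2 \<bullet> k1))))))))"
    unfolding la_times
    by ((rule cop_cong)+, rule cop_hom[where g = "\<lambda>x. pure (y * x) z" for y z, OF module_A module_R])
       (simp_all add: distrib_left pure_add pure_scale sc_mult_right[symmetric])
  also have "\<dots> = ?E g (\<lambda>g1 g'. ?E k (\<lambda>k' k3. ?E h (\<lambda>h' h3. ?E g' (\<lambda>g2 g3. ?E k' (\<lambda>k1 k2. ?E h' (\<lambda>h1 h2.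
      N h1 h2 h3 g1 g2 g3 k1 k2 k3))))))"
    by (simp only: N_def ra_mul la_mul la_ra mult.assoc mul_assoc)
  \<comment> \<open>Here the two module laws and the commutation of both actions on \<open>b\<close>
    make the sides meet in \<open>N\<close>; everything after this only reorders coproducts.\<close>
  also have "\<dots> = ?E g (\<lambda>g1 g'. ?E k (\<lambda>k' k3. ?E h (\<lambda>h' h3. ?E g' (\<lambda>g2 g3. ?E h' (\<lambda>h1 h2. ?E k' (\<lambda>k1 k2.
      N h1 h2 h3 g1 g2 g3 k1 k2 k3))))))"
    by (rule cop_cong, rule cop_cong, rule cop_cong, rule cop_cong, rule cop_swap[OF s])
  also have "\<dots> = ?E g (\<lambda>g1 g'. ?E k (\<lambda>k' k3. ?E h (\<lambda>h' h3. ?E h' (\<lambda>h1 h2. ?E g' (\<lambda>g2 g3. ?E k' (\<lambda>k1 k2.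
      N h1 h2 h3 g1 g2 g3 k1 k2 k3))))))"
    by (rule cop_cong, rule cop_cong, rule cop_cong, rule cop_swap[OF s])
  also have "\<dots> = ?E g (\<lambda>g1 g'. ?E h (\<lambda>h' h3. ?E k (\<lambda>k' k3. ?E h' (\<lambda>h1 h2. ?E g' (\<lambda>g2 g3. ?E k' (\<lambda>k1 k2.
      N h1 h2 h3 g1 g2 g3 k1 k2 k3))))))"
    by (rule cop_cong, rule cop_swap[OF s])
  also have "\<dots> = ?E h (\<lambda>h' h3. ?E g (\<lambda>g1 g'. ?E k (\<lambda>k' k3. ?E h' (\<lambda>h1 h2. ?E g' (\<lambda>g2 g3. ?E k' (\<lambda>k1 k2.
      N h1 h2 h3 g1 g2 g3 k1 k2 k3))))))"
    by (rule cop_swap[OF s])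
  also have "\<dots> = ?E h (\<lambda>h' h3. ?E g (\<lambda>g1 g'. ?E h' (\<lambda>h1 h2. ?E k (\<lambda>k' k3. ?E g' (\<lambda>g2 g3. ?E k' (\<lambda>k1 k2.
      N h1 h2 h3 g1 g2 g3 k1 k2 k3))))))"
    by (rule cop_cong, rule cop_cong, rule cop_swap[OF s])
  also have "\<dots> = ?E h (\<lambda>h' h3. ?E h' (\<lambda>h1 h2. ?E g (\<lambda>g1 g'. ?E k (\<lambda>k' k3. ?E g' (\<lambda>g2 g3. ?E k' (\<lambda>k1 k2.
      N h1 h2 h3 g1 g2 g3 k1 k2 k3))))))"
    by (rule cop_cong, rule cop_swap[OF s])
  also have "\<dots> = ?E h (\<lambda>h' h3. ?E h' (\<lambda>h1 h2. ?E g (\<lambda>g1 g'. ?E g' (\<lambda>g2 g3. ?E k (\<lambda>k' k3. ?E k' (\<lambda>k1 k2.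
      N h1 h2 h3 g1 g2 g3 k1 k2 k3))))))"
    by (rule cop_cong, rule cop_cong, rule cop_cong, rule cop_swap[OF s])
  also have "\<dots> = ?E h (\<lambda>h' h3. ?E h' (\<lambda>h1 h2. ?E g (\<lambda>g1 g'. ?E g' (\<lambda>g2 g3. ?E k (\<lambda>k1 k'. ?E k' (\<lambda>k2 k3.
      N h1 h2 h3 g1 g2 g3 k1 k2 k3))))))"
    by (rule cop_cong, rule cop_cong, rule cop_cong, rule cop_cong, rule coassoc[OF s])
  also have "\<dots> = ?E h (\<lambda>h1 h'. ?E h' (\<lambda>h2 h3. ?E g (\<lambda>g1 g'. ?E g' (\<lambda>g2 g3. ?E k (\<lambda>k1 k'. ?E k' (\<lambda>k2 k3.
      N h1 h2 h3 g1 g2 g3 k1 k2 k3))))))"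
    by (rule coassoc[OF s])
  finally show ?thesis unfolding L ..
qed

lemma smash_assoc: "x \<natural> y \<natural> z = x \<natural> (y \<natural> z)"
  by (subst pure_expand[of x], subst (2) pure_expand[of x], subst pure_expand[of y], subst (2) pure_expand[of y],
      subst pure_expand[of z], subst (2) pure_expand[of z])
    (simp only: smash_sum_left smash_sum_right smash_assoc_pure)

lemma smash_one_left [simp]: "pure 1 u \<natural> x = x"
proof -
  have "pure 1 u \<natural> pure b g = pure b g" for b g
  proof -
    have "pure 1 u \<natural> pure b g = D (pw sc) g (\<lambda>g1 g2. pure (ra 1 g2 * la u b) (u \<bullet> g1))"
      unfolding smash_pure by (rule cop_one, (rule lin_intro)+)
    also have "\<dots> = D (pw sc) g (\<lambda>g1 g2. pw sc (cou g2) (pure b g1))"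
      by (simp add: ra_unit sc_mult_left[symmetric] pure_scale)
    also have "\<dots> = pure b g" by (rule counit_right, (rule lin_intro)+)
    finally show ?thesis .
  qed
  then have "(\<Sum>i\<in>UNIV. pure 1 u \<natural> pure (x i) (bas i)) = (\<Sum>i\<in>UNIV. pure (x i) (bas i))" by simp
  then show ?thesis by (simp only: smash_sum_right[symmetric] pure_expand[symmetric])
qed

lemma pure_smash_one: "pure 1 h \<natural> pure b u = D (pw sc) h (\<lambda>h1 h2. pure (la h1 b) h2)"
proof -
  have "pure 1 h \<natural> pure b u = D (pw sc) h (\<lambda>h1 h2. pure (ra 1 u * la h1 b) (h2 \<bullet> u))"
    unfolding smash_pure by (rule cop_cong, rule cop_one, (rule lin_intro)+)
  then show ?thesis by simp
qed

lemma one_smash_pure: "pure a u \<natural> pure b h = D (pw sc) h (\<lambda>h1 h2. pure (ra a h2 * b) h1)"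
proof -
  have "pure a u \<natural> pure b h = D (pw sc) h (\<lambda>h1 h2. pure (ra a h2 * la u b) (u \<bullet> h1))"
    unfolding smash_pure by (rule cop_one, (rule lin_intro)+)
  then show ?thesis by simp
qed

lemma pure_smash_pure_one: "pure 1 h \<natural> pure 1 g = pure 1 (h \<bullet> g)"
proof -
  have "pure 1 h \<natural> pure 1 g = D (pw sc) h (\<lambda>h1 h2. D (pw sc) g (\<lambda>g1 g2. pw sc (cou g2) (pw sc (cou h1) (pure 1 (h2 \<bullet> g1)))))"
    unfolding smash_pure by (simp add: ra_unit la_unit sc_mult_left[symmetric] pure_scale)
  also have "\<dots> = D (pw sc) h (\<lambda>h1 h2. pw sc (cou h1) (pure 1 (h2 \<bullet> g)))"
    by (rule cop_cong, rule counit_right, (rule lin_intro)+)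
  also have "\<dots> = pure 1 (h \<bullet> g)"
    by (rule counit_left, (rule lin_intro)+)
  finally show ?thesis .
qed

lemma smash_one_right [simp]: "x \<natural> pure 1 u = x"
proof -
  have "pure b g \<natural> pure 1 u = pure b g" for b g
  proof -
    have "pure b g \<natural> pure 1 u = D (pw sc) g (\<lambda>g1 g2. pure (ra b u * la g1 1) (g2 \<bullet> u))"
      unfolding smash_pure by (rule cop_cong, rule cop_one, (rule lin_intro)+)
    also have "\<dots> = D (pw sc) g (\<lambda>g1 g2. pw sc (cou g1) (pure b g2))"
      by (simp add: la_unit sc_mult_right[symmetric] pure_scale)
    also have "\<dots> = pure b g" by (rule counit_left, (rule lin_intro)+)
    finally show ?thesis .
  qed
  then have "(\<Sum>i\<in>UNIV. pure (x i) (bas i) \<natural> pure 1 u) = (\<Sum>i\<in>UNIV. pure (x i) (bas i))" by simp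
  then show ?thesis by (simp only: smash_sum_left[symmetric] pure_expand[symmetric])
qed

text \<open>The product of a \<natural> 1 and 1 \<natural> h is (a . h_2) \<natural> h_1. For h =
  S(g_2) this translation is undone by letting g_1 act first, because g_1 S(g_2) cancels.\<close>

lemma pure_ant: "pure a (ant g) = D (pw sc) g (\<lambda>g1 g2. pure (ra a g1) u \<natural> pure 1 (ant g2))"
proof -
  let ?E = "D (pw sc)"
  have "?E g (\<lambda>g1 g2. pure (ra a g1) u \<natural> pure 1 (ant g2)) =
      ?E g (\<lambda>g1 g'. ?E (ant g') (\<lambda>x y. pure (ra (ra a g1) y) x))"
    by (simp add: one_smash_pure)
  also have "\<dots> = ?E g (\<lambda>g1 g'. ?E g' (\<lambda>g2 g3. pure (ra (ra a g1) (ant g2)) (ant g3)))"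
    by (rule cop_cong, rule cop_ant, (rule lin_intro)+)
  also have "\<dots> = ?E g (\<lambda>k g3. ?E k (\<lambda>g1 g2. pure (ra a (g1 \<bullet> ant g2)) (ant g3)))"
    unfolding ra_mul by (rule coassoc[OF module_R, symmetric])
  also have "\<dots> = ?E g (\<lambda>k g3. pw sc (cou k) (pure (ra a u) (ant g3)))"
    by (rule cop_cong, rule antipode_right, (rule lin_intro)+)
  also have "\<dots> = pure (ra a u) (ant g)"
    by (rule counit_left, (rule lin_intro)+)
  finally show ?thesis by simp
qed

lemma smash_emb: "smash_emb u sc x = pure x u"
  by (simp add: smash_emb_def pure_def)

lemma ring_smash_ring: "ring (smash_ring m u d sc lact ract)"
proof (rule ringI)
  let ?R = "smash_ring m u d sc lact ract"
  show "abelian_group ?R"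
    by (rule abelian_groupI) (auto simp: smash_ring_def add.assoc intro: add.commute exI[of _ "- x" for x])
  show "monoid ?R"
    by unfold_locales (simp_all add: smash_ring_def smash_emb smash_assoc)
qed (simp_all add: smash_ring_def smash_add_left smash_add_right)

end

section \<open>Complements\<close>

lemma sum_mem:
  assumes "0 \<in> C" "\<And>x y. x \<in> C \<Longrightarrow> y \<in> C \<Longrightarrow> x + y \<in> C" "\<And>i. i \<in> I \<Longrightarrow> f i \<in> C"
  shows "sum f I \<in> C"
  using assms(3) by (induction I rule: infinite_finite_induct) (auto simp: assms(1,2))

text \<open>Complements cannot be averaged, but projections can. The projection runs along the given
  complement; conversely the kernel of a projection is a complement.\<close>

lemma has_complement_iff_projection:
  fixes act :: "'r \<Rightarrow> 'v::ab_group_add \<Rightarrow> 'v"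
  assumes act_add: "\<And>r v w. r \<in> carrier R \<Longrightarrow> act r (v + w) = act r v + act r w"
    and W: "submodule_of R act W"
  shows "has_complement R act W \<longleftrightarrow>
    (\<exists>p. (\<forall>v w. p (v + w) = p v + p w) \<and> (\<forall>v. p v \<in> W) \<and> (\<forall>w\<in>W. p w = w) \<and>
         (\<forall>r\<in>carrier R. \<forall>v. p (act r v) = act r (p v)))" (is "_ \<longleftrightarrow> (\<exists>p. ?P p)")
proof
  note W' = W[unfolded submodule_of_def]
  assume "has_complement R act W"
  then obtain C where C: "submodule_of R act C" "W \<inter> C = {0}" "\<And>v. \<exists>x\<in>W. \<exists>y\<in>C. v = x + y"
    unfolding has_complement_def by blast
  note C' = C(1)[unfolded submodule_of_def]
  from C(3) have "\<exists>x. x \<in> W \<and> v - x \<in> C" for v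
    by (metis add_diff_cancel_left')
  then obtain p where p: "\<And>v. p v \<in> W" "\<And>v. v - p v \<in> C" by metis
  \<comment> \<open>The condition v - x \<in> C pins down the value of the projection; additivity,
    the identity on W and linearity are all read off from it.\<close>
  have uniq: "p v = x" if "x \<in> W" "v - x \<in> C" for v x
  proof -
    have "p v + - x \<in> W" using p(1) that(1) W' by blast
    moreover have "(v - x) + - (v - p v) \<in> C" using p(2) that(2) C' by blast
    ultimately have "p v - x \<in> W \<inter> C" by simp
    then have "p v - x = 0" using C(2) by blast
    then show ?thesis by simp
  qed
  have "p (v + w) = p v + p w" for v w
  proof (rule uniq)
    show "p v + p w \<in> W" using p(1) W' by blast
    have "(v - p v) + (w - p w) \<in> C" using p(2) C' by blast
    then show "v + w - (p v + p w) \<in> C" by (simp add: algebra_simps)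
  qed
  moreover have "p w = w" if "w \<in> W" for w using that C' by (auto intro: uniq)
  moreover have "p (act r v) = act r (p v)" if r: "r \<in> carrier R" for r v
  proof (rule uniq)
    show "act r (p v) \<in> W" using r p(1) W' by blast
    have "act r (v - p v) \<in> C" using r p(2) C' by blast
    moreover have "act r v = act r (v - p v) + act r (p v)"
      using act_add[OF r, of "v - p v" "p v"] by simp
    ultimately show "act r v - act r (p v) \<in> C" by simp
  qed
  ultimately show "\<exists>p. ?P p" using p(1) by blast
next
  assume "\<exists>p. ?P p"
  then obtain p where p: "?P p" ..
  have p0: "p 0 = 0" using W p by (auto simp: submodule_of_def)
  have pm: "p (- v) = - p v" for v
    using p p0 by (metis add.right_inverse add_eq_0_iff2 minus_unique)
  have act0: "act r 0 = 0" if "r \<in> carrier R" for r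
    using act_add[OF that, of 0 0] by simp
  show "has_complement R act W"
    unfolding has_complement_def
  proof (intro exI[of _ "{v. p v = 0}"] conjI allI)
    show "submodule_of R act {v. p v = 0}"
      using p p0 pm act0 by (auto simp: submodule_of_def)
    show "W \<inter> {v. p v = 0} = {0}" using p p0 W by (auto simp: submodule_of_def)
    fix v
    have "p (v - p v) = 0" using p pm by (metis add.right_inverse diff_conv_add_uminus)
    then show "\<exists>x\<in>W. \<exists>y\<in>{v. p v = 0}. v = x + y"
      using p by (intro bexI[of _ "p v"] bexI[of _ "v - p v"]) auto
  qed
qed

text \<open>Finite generation replaces a maximality argument: the generators are brought into W + C
  one at a time by enlarging C, while W \<inter> C = 0 is kept.\<close>

lemma semisimple_has_complement:
  fixes act :: "'a::ring_1 \<Rightarrow> 'v::ab_group_add \<Rightarrow> 'v" and g :: "'i \<Rightarrow> 'v"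
  assumes ss: "semisimple_artinian (A_ring :: 'a ring)"
    and V: "lmodule A_ring act" and W: "submodule_of A_ring act W"
    and I: "finite I" and gen: "\<And>C. \<lbrakk>submodule_of A_ring act C; g ` I \<subseteq> C\<rbrakk> \<Longrightarrow> C = UNIV"
  shows "has_complement A_ring act W"
proof -
  let ?sub = "submodule_of A_ring act"
  have act: "act r (v + w) = act r v + act r w" "act (r + r') v = act r v + act r' v"
    "act (r * r') v = act r (act r' v)" "act 1 v = v" for r r' v w
    using V by (simp_all add: lmodule_def A_ring_def)
  have act0: "act r 0 = 0" "act 0 v = 0" for r v
    using act(1)[of r 0 0] act(2)[of 0 0 v] by simp_all
  have actm: "act (- r) v = - act r v" "act r (- v) = - act r v" for r v
    using act(1)[of r v "- v"] act(2)[of r "- r" v] by (simp_all add: act0 add_eq_0_iff2)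
  have sub: "?sub C \<longleftrightarrow> 0 \<in> C \<and> (\<forall>x\<in>C. \<forall>y\<in>C. x + y \<in> C) \<and> (\<forall>r. \<forall>x\<in>C. act r x \<in> C)" for C
  proof -
    have "- x = act (- 1) x" for x by (simp add: actm act(4))
    then show ?thesis by (auto simp: submodule_of_def A_ring_def)
  qed
  have plusI: "x + y \<in> {x + y |x y. x \<in> B \<and> y \<in> C}" if "x \<in> B" "y \<in> C" for x y :: 'v and B C
    using that by blast
  have sub_plus: "?sub {x + y |x y. x \<in> B \<and> y \<in> C}" if B: "?sub B" and C: "?sub C" for B C
  proof -
    have "\<exists>x' y'. x1 + y1 + (x2 + y2) = x' + y' \<and> x' \<in> B \<and> y' \<in> C"
      if "x1 \<in> B" "y1 \<in> C" "x2 \<in> B" "y2 \<in> C" for x1 y1 x2 y2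
      using that B C unfolding sub
      by (intro exI[of _ "x1 + x2"] exI[of _ "y1 + y2"]) (auto simp: algebra_simps)
    moreover have "\<exists>x y. 0 = x + y \<and> x \<in> B \<and> y \<in> C"
      using B C unfolding sub by (intro exI[of _ 0]) auto
    moreover have "\<exists>x' y'. act r (x + y) = x' + y' \<and> x' \<in> B \<and> y' \<in> C" if "x \<in> B" "y \<in> C" for r x y
      using B C that unfolding sub by (intro exI[of _ "act r x"] exI[of _ "act r y"]) (auto simp: act(1))
    ultimately show ?thesis unfolding sub[of "{x + y |x y. x \<in> B \<and> y \<in> C}"] by blast
  qed
  have ideal: "left_ideal A_ring L \<longleftrightarrow> submodule_of A_ring (*) L" for L :: "'a set"
    using left_ideal_iff_submodule[of "A_ring :: 'a ring" L] ss
    by (simp add: semisimple_artinian_def A_ring_def)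
  have "\<exists>C. ?sub C \<and> W \<inter> C = {0} \<and> g ` J \<subseteq> {x + y |x y. x \<in> W \<and> y \<in> C}" if "finite J" for J
    using that
  proof (induction J rule: finite_induct)
    case empty
    have "?sub {0}" by (auto simp: sub act0)
    then show ?case using W by (intro exI[of _ "{0}"]) (auto simp: sub)
  next
    case (insert j J)
    then obtain C where C: "?sub C" "W \<inter> C = {0}" "g ` J \<subseteq> {x + y |x y. x \<in> W \<and> y \<in> C}" by blast
    define U where "U = {x + y |x y. x \<in> W \<and> y \<in> C}"
    have U: "?sub U" unfolding U_def by (rule sub_plus[OF W C(1)])
    \<comment> \<open>These are the coefficients that already send \<open>g j\<close> into W + C. A
      complementary left ideal \<open>L\<close> shows which multiples of \<open>g j\<close> must be
      added to C.\<close>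
    have "left_ideal A_ring {a. act a (g j) \<in> U}"
      unfolding ideal submodule_of_def
      using U[unfolded submodule_of_def] by (simp add: act(2,3) act0 actm A_ring_def)
    then obtain L where L: "left_ideal A_ring L" "{a. act a (g j) \<in> U} \<inter> L = {0}"
      "\<And>x. \<exists>a\<in>{a. act a (g j) \<in> U}. \<exists>b\<in>L. x = a + b"
      using ss unfolding semisimple_artinian_def by (auto simp: A_ring_def)
    have L': "0 \<in> L" "\<And>x y. x \<in> L \<Longrightarrow> y \<in> L \<Longrightarrow> x + y \<in> L" "\<And>a x. x \<in> L \<Longrightarrow> a * x \<in> L"
      using L(1) unfolding ideal submodule_of_def by (simp_all add: A_ring_def)
    have "act a (g j) \<in> (\<lambda>a. act a (g j)) ` L" if "a \<in> L" for a using that by blast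
    then have "?sub ((\<lambda>a. act a (g j)) ` L)"
      unfolding sub using L' act0(2) by (force simp: act(2,3)[symmetric])
    note sub' = sub_plus[OF C(1) this]
    let ?C = "{x + y |x y. x \<in> C \<and> y \<in> (\<lambda>a. act a (g j)) ` L}"
    have CC: "C \<subseteq> ?C"
    proof
      fix x assume "x \<in> C"
      moreover have "0 \<in> (\<lambda>a. act a (g j)) ` L" using imageI[OF L'(1), of "\<lambda>a. act a (g j)"] by (simp add: act0)
      ultimately show "x \<in> ?C" by (intro CollectI exI[of _ x] exI[of _ 0]) simp
    qed
    \<comment> \<open>The element \<open>act a (g j)\<close> = w - c lies in W + C, so
      \<open>a\<close> is in both left ideals and vanishes; then w = c lies in W \<inter> C.\<close>
    have zero: "w = 0" if "w \<in> W" "w = c + act a (g j)" "c \<in> C" "a \<in> L" for w c a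
    proof -
      have "act (- 1) c \<in> C" using that(3) C(1) unfolding sub by blast
      then have "w + act (- 1) c \<in> U" unfolding U_def using that(1) by blast
      moreover have "act a (g j) = w + act (- 1) c" unfolding that(2) by (simp add: actm(1) act(4))
      ultimately have "a \<in> {a. act a (g j) \<in> U} \<inter> L" using that(4) by simp
      then have "a = 0" using L(2) by blast
      then have "w = c" using that(2) act0(2) by simp
      then show ?thesis using that(1,3) C(2) by blast
    qed
    have "0 \<in> W" "0 \<in> C" using W C(1) unfolding sub by blast+
    then have "W \<inter> ?C = {0}" using CC zero by blast
    moreover have "g ` insert j J \<subseteq> {x + y |x y. x \<in> W \<and> y \<in> ?C}"
    proof -
      \<comment> \<open>Splitting the unit writes \<open>g j\<close> as an element of W + C plus an
        element of L \<open>g j\<close>.\<close>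
      obtain a b where ab: "act a (g j) \<in> U" "b \<in> L" "1 = a + b" using L(3)[of 1] by blast
      then obtain w c where wc: "act a (g j) = w + c" "w \<in> W" "c \<in> C" by (auto simp: U_def)
      have "g j = act (a + b) (g j)" by (simp only: ab(3)[symmetric] act(4))
      also have "\<dots> = w + (c + act b (g j))" by (simp only: act(2) wc(1) add.assoc)
      finally have g_eq: "g j = w + (c + act b (g j))" .
      have "c + act b (g j) \<in> ?C"
        by (rule plusI[OF wc(3) imageI[OF ab(2)]])
      then have "g j \<in> {x + y |x y. x \<in> W \<and> y \<in> ?C}"
        by (subst g_eq) (rule plusI[OF wc(2)])
      moreover have "{x + y |x y. x \<in> W \<and> y \<in> C} \<subseteq> {x + y |x y. x \<in> W \<and> y \<in> ?C}"
        using CC by (intro Collect_mono ex_mono) auto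
      ultimately show ?thesis using C(3) unfolding image_insert insert_subset by (intro conjI order_trans[OF C(3)])
    qed
    ultimately show ?case using sub' by blast
  qed
  from this[OF I] obtain C where C: "?sub C" "W \<inter> C = {0}" "g ` I \<subseteq> {x + y |x y. x \<in> W \<and> y \<in> C}" by blast
  from gen[OF sub_plus[OF W C(1)] C(3)] have "\<exists>x\<in>W. \<exists>y\<in>C. v = x + y" for v by blast
  with C show ?thesis unfolding has_complement_def by blast
qed

section \<open>Averaging projections over the integral\<close>

locale integral_bimodule = integral_hopf m u eps d S t + bimodule_hopf m u eps d S sc lact ract
  for m :: "'n::finite \<Rightarrow> 'n \<Rightarrow> 'n \<Rightarrow> 'k::field" and u eps d S t
    and sc :: "'k \<Rightarrow> 'a::ring_1 \<Rightarrow> 'a" and lact ract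
begin

lemma smash_has_complement:
  fixes act :: "('n \<Rightarrow> 'a) \<Rightarrow> 'v::ab_group_add \<Rightarrow> 'v"
  assumes V: "lmodule (smash_ring m u d sc lact ract) act"
    and W: "submodule_of (smash_ring m u d sc lact ract) act W"
    and A: "has_complement A_ring (\<lambda>x. act (smash_emb u sc x)) W"
  shows "has_complement (smash_ring m u d sc lact ract) act W"
proof -
  let ?R = "smash_ring m u d sc lact ract"
  have act: "act r (v + w) = act r v + act r w" "act (r + r') v = act r v + act r' v"
    "act (r \<natural> r') v = act r (act r' v)" "act (pure 1 u) v = v" for r r' v w
    using V by (simp_all add: lmodule_def smash_ring_def smash_emb)
  have W': "0 \<in> W" "\<And>x y. x \<in> W \<Longrightarrow> y \<in> W \<Longrightarrow> x + y \<in> W" "\<And>r x. x \<in> W \<Longrightarrow> act r x \<in> W"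
    using W by (simp_all add: submodule_of_def smash_ring_def)
  have "submodule_of A_ring (\<lambda>x. act (smash_emb u sc x)) W"
    using W by (simp add: submodule_of_def A_ring_def smash_ring_def)
  from iffD1[OF has_complement_iff_projection[OF act(1) this] A]
  obtain p where p: "\<And>v w. p (v + w) = p v + p w" "\<And>v. p v \<in> W" "\<And>w. w \<in> W \<Longrightarrow> p w = w"
    and "\<And>r v. r \<in> carrier A_ring \<Longrightarrow> p (act (smash_emb u sc r) v) = act (smash_emb u sc r) (p v)"
    by blast
  from this(4) have p4: "p (act (pure a u) v) = act (pure a u) (p v)" for a v
    by (simp add: A_ring_def smash_emb)
  \<comment> \<open>V comes without scalars of its own, so the field acts through (c 1) \<natural>
    1. These elements are central in the smash product and come from A, which makes
    \<open>act\<close> and \<open>p\<close> linear for \<open>sV\<close>.\<close>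
  define sV where "sV c = act (pure (sc c 1) u)" for c
  have pure_sc: "pure (sc c 1) u \<natural> r = pw sc c r" "r \<natural> pure (sc c 1) u = pw sc c r" for c r
    by (simp_all add: pure_scale smash_scale_left smash_scale_right)
  have s: "module sV"
  proof
    fix c e v w
    show "sV c (v + w) = sV c v + sV c w" "sV (c + e) v = sV c v + sV e v" "sV 1 v = v"
      by (simp_all add: sV_def act(1,2,4) sc.scale_left_distrib pure_add flip: act(2))
    show "sV c (sV e v) = sV (c * e) v"
      by (simp only: sV_def act(3)[symmetric] pure_sc(1) pure_scale[symmetric] sc.scale_scale)
  qed
  have act_scale: "act (pw sc c r) v = sV c (act r v)" "act r (sV c v) = sV c (act r v)" for c r v
    by (simp_all add: sV_def act(3)[symmetric] pure_sc)
  have p_scale: "p (sV c v) = sV c (p v)" for c v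
    by (simp add: sV_def p4)
  note act_cop1 = cop_hom[where g = "\<lambda>r. act r v" for v, OF module_R s act(2) act_scale(1)]
  note act_cop2 = cop_hom[where g = "act r" for r, OF s s act(1) act_scale(2)]
  note p_cop = cop_hom[where g = p, OF s s p(1) p_scale]
  have lin_act1: "lin sV (\<lambda>x. act (f x) v)" if "lin (pw sc) f" for v and f :: "('n \<Rightarrow> 'k) \<Rightarrow> _"
    by (rule lin_post[where g = "\<lambda>r. act r v", OF that s act(2) act_scale(1)])
  have lin_act2: "lin sV (\<lambda>x. act r (f x))" if "lin sV f" for r and f :: "('n \<Rightarrow> 'k) \<Rightarrow> _"
    by (rule lin_post[where g = "act r", OF that s act(1) act_scale(2)])
  have lin_p: "lin sV (\<lambda>x. p (f x))" if "lin sV f" for f :: "('n \<Rightarrow> 'k) \<Rightarrow> _"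
    by (rule lin_post[where g = p, OF that s p(1) p_scale])
  note L = lin_intro lin_act1 lin_act2 lin_p s

  let ?E = "D sV"
  \<comment> \<open>The averaged projection v |-> t_1 p(S(t_2) v).\<close>
  define P where "P v = ?E t (\<lambda>a b. act (pure 1 a) (p (act (pure 1 (ant b)) v)))" for v
  have cop_mem: "?E h F \<in> W" if "\<And>a b. F a b \<in> W" for h F
    unfolding cop_def sV_def by (intro sum_mem[OF W'(1,2)] W'(3) that)
  have act_pure_ant: "act (pure a (ant g)) v = ?E g (\<lambda>g1 g2. act (pure (ra a g1) u) (act (pure 1 (ant g2)) v))" for a g v
    by (subst pure_ant) (simp only: act_cop1 act(3))
  have P_mem: "P v \<in> W" for v unfolding P_def by (intro cop_mem W'(3) p(2))
  have P_id: "P w = w" if "w \<in> W" for w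
  proof -
    \<comment> \<open>S(t_2) w stays in W, where \<open>p\<close> is the identity, so only t_1
      S(t_2) acts.\<close>
    have "P w = ?E t (\<lambda>a b. act (pure 1 (a \<bullet> ant b)) w)"
      by (simp add: P_def p(3) W'(3) that act(3)[symmetric] pure_smash_pure_one)
    also have "\<dots> = sV (cou t) (act (pure 1 u) w)"
      by (rule antipode_right, (rule L)+)
    finally show ?thesis by (simp add: act(4) module.scale_one[OF s])
  qed
  have P_add: "P (v + w) = P v + P w" for v w
  proof -
    interpret module sV by fact
    show ?thesis by (simp add: P_def act(1) p(1) cop_def sum.distrib scale_right_distrib)
  qed
  have P_H: "P (act (pure 1 h) v) = act (pure 1 h) (P v)" for h v
  proof -
    have "act (pure 1 h) (P v) = ?E t (\<lambda>a b. act (pure 1 (h \<bullet> a)) (p (act (pure 1 (ant b)) v)))"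
      by (simp add: P_def act_cop2 act(3)[symmetric] pure_smash_pure_one)
    also have "\<dots> = ?E t (\<lambda>a b. act (pure 1 a) (p (act (pure 1 (ant b \<bullet> h)) v)))"
      by (rule casimir, (rule L)+)
    also have "\<dots> = P (act (pure 1 h) v)"
      by (simp add: P_def act(3)[symmetric] pure_smash_pure_one)
    finally show ?thesis ..
  qed
  have P_A: "P (act (pure \<phi> u) v) = act (pure \<phi> u) (P v)" for \<phi> v
  proof -
    have act_H_A: "act (pure 1 h) (act (pure \<psi> u) w) = ?E h (\<lambda>x y. act (pure (la x \<psi>) y) w)" for h \<psi> w
      by (simp only: act(3)[symmetric] pure_smash_one act_cop1)
    have act_A_H: "act (pure \<psi> u) (act (pure 1 h) w) = ?E h (\<lambda>x y. act (pure (ra \<psi> y) x) w)" for h \<psi> w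
      by (simp only: act(3)[symmetric] one_smash_pure act_cop1 mult_1_right)
    \<comment> \<open>As \<open>p\<close> commutes with A, the algebra factor has to stand
      outermost. \<open>act_pure_ant\<close> achieves this, since the H-part left by
      \<open>cop_ant\<close> is an antipode.\<close>
    have *: "act (pure 1 (ant b)) (act (pure \<phi> u) v) =
        ?E b (\<lambda>b1 b2. ?E b1 (\<lambda>c1 c2. act (pure (ra (la (ant b2) \<phi>) c1) u) (act (pure 1 (ant c2)) v)))" for b
    proof -
      have "act (pure 1 (ant b)) (act (pure \<phi> u) v) = ?E (ant b) (\<lambda>x y. act (pure (la x \<phi>) y) v)"
        by (rule act_H_A)
      also have "\<dots> = ?E b (\<lambda>b1 b2. act (pure (la (ant b2) \<phi>) (ant b1)) v)"
        by (rule cop_ant, (rule L)+)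
      also have "\<dots> = ?E b (\<lambda>b1 b2. ?E b1 (\<lambda>c1 c2. act (pure (ra (la (ant b2) \<phi>) c1) u) (act (pure 1 (ant c2)) v)))"
        by (rule cop_cong, rule act_pure_ant)
      finally show ?thesis .
    qed
    \<comment> \<open>After reordering, the legs t_1, ..., t_5 are a1, a2, c1, c2, b2. The outer two
      occur only in the first argument of \<open>G\<close>, as t_1 S(t_5).\<close>
    define G where "G g c1 a2 c2 = act (pure (ra (la g \<phi>) c1) a2) (p (act (pure 1 (ant c2)) v))" for g c1 a2 c2
    have "P (act (pure \<phi> u) v) =
        ?E t (\<lambda>a b. ?E b (\<lambda>b1 b2. ?E b1 (\<lambda>c1 c2. ?E a (\<lambda>a1 a2. G (a1 \<bullet> ant b2) c1 a2 c2))))"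
      by (simp only: P_def * p_cop p4 act_cop2) (simp only: act_H_A G_def la_mul la_ra)
    also have "\<dots> = ?E t (\<lambda>a b. ?E b (\<lambda>b1 b2. ?E a (\<lambda>a1 a2. ?E b1 (\<lambda>c1 c2. G (a1 \<bullet> ant b2) c1 a2 c2))))"
      by (rule cop_cong, rule cop_cong, rule cop_swap[OF s])
    also have "\<dots> = ?E t (\<lambda>a b. ?E a (\<lambda>a1 a2. ?E b (\<lambda>b1 b2. ?E b1 (\<lambda>c1 c2. G (a1 \<bullet> ant b2) c1 a2 c2))))"
      by (rule cop_cong, rule cop_swap[OF s])
    also have "\<dots> = ?E t (\<lambda>a1 z. ?E z (\<lambda>a2 b. ?E b (\<lambda>b1 b2. ?E b1 (\<lambda>c1 c2. G (a1 \<bullet> ant b2) c1 a2 c2))))"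
      by (rule coassoc[OF s])
    also have "\<dots> = ?E t (\<lambda>a1 z. ?E z (\<lambda>x b2. ?E x (\<lambda>a2 b1. ?E b1 (\<lambda>c1 c2. G (a1 \<bullet> ant b2) c1 a2 c2))))"
      by (rule cop_cong, rule coassoc[OF s, symmetric])
    \<comment> \<open>\<open>integral_cyclic\<close> is used with its middle leg split further into
      a2, c1, c2; the translation of \<phi> by the outer legs disappears.\<close>
    also have "\<dots> = ?E t (\<lambda>a2 b1. ?E b1 (\<lambda>c1 c2. G u c1 a2 c2))"
      unfolding G_def by (rule integral_cyclic, (rule L)+)
    also have "\<dots> = ?E t (\<lambda>x c2. ?E x (\<lambda>a2 c1. G u c1 a2 c2))"
      by (rule coassoc[OF s, symmetric])
    \<comment> \<open>The remaining (\<phi> . t_2) \<natural> t_1 is the product of \<phi>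
      \<natural> 1 and 1 \<natural> t_1.\<close>
    also have "\<dots> = act (pure \<phi> u) (P v)"
      by (simp only: P_def act_cop2 act_A_H G_def la_one)
    finally show ?thesis .
  qed
  have P_scale: "P (sV c v) = sV c (P v)" for c v by (simp add: sV_def P_A)
  note P_cop = cop_hom[where g = P, OF s s P_add P_scale]
  have P_pure: "P (act (pure a h) v) = act (pure a h) (P v)" for a h v
  proof -
    obtain g where g: "h = ant g" using ant_surj by blast
    show ?thesis
      by (simp only: g act_pure_ant[of a] P_cop P_A P_H)
  qed
  have act_sum: "act (\<Sum>i\<in>I. f i) v = (\<Sum>i\<in>I. act (f i) v)" for f v and I :: "'n set"
    by (rule additive_sum[of "\<lambda>r. act r v", OF act(2)])
  have P_R: "P (act r v) = act r (P v)" for r v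
  proof -
    have "P (act (\<Sum>i\<in>UNIV. pure (r i) (bas i)) v) = act (\<Sum>i\<in>UNIV. pure (r i) (bas i)) (P v)"
      by (simp only: act_sum additive_sum[of P, OF P_add] P_pure)
    then show ?thesis by (simp only: pure_expand[symmetric])
  qed
  show ?thesis
    unfolding has_complement_iff_projection[OF act(1) W]
    using P_add P_mem P_id P_R by blast
qed

lemma semisimple_smash_ring:
  assumes ss: "semisimple_artinian (A_ring :: 'a ring)"
  shows "semisimple_artinian (smash_ring m u d sc lact ract)"
proof -
  let ?R = "smash_ring m u d sc lact ract"
  have R: "carrier ?R = UNIV" "\<And>x y. x \<otimes>\<^bsub>?R\<^esub> y = x \<natural> y" "\<And>x y. x \<oplus>\<^bsub>?R\<^esub> y = x + y"
    "\<zero>\<^bsub>?R\<^esub> = 0" "\<one>\<^bsub>?R\<^esub> = pure 1 u"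
    by (simp_all add: smash_ring_def smash_emb)
  have ideal: "left_ideal ?R L \<longleftrightarrow> submodule_of ?R (\<natural>) L" for L
    using left_ideal_iff_submodule[OF ring_smash_ring, of L] by (simp add: R) (simp add: smash_ring_def)
  have V: "lmodule ?R (\<natural>)"
    by (simp add: lmodule_def R smash_add_left smash_add_right smash_assoc)
  have pure_mul: "pure a u \<natural> pure b u = pure (a * b) u" for a b
    unfolding one_smash_pure by (subst cop_one, (rule lin_intro)+) simp
  have "has_complement ?R (\<natural>) L" if L: "submodule_of ?R (\<natural>) L" for L
  proof (rule smash_has_complement[OF V L])
    let ?act = "\<lambda>x. (\<natural>) (smash_emb u sc x)"
    have VA: "lmodule A_ring ?act"
      by (simp add: lmodule_def A_ring_def smash_emb smash_add_left smash_add_right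
          pure_add pure_mul[symmetric] smash_assoc)
    have LA: "submodule_of A_ring ?act L"
      using L by (simp add: submodule_of_def R A_ring_def)
    show "has_complement A_ring ?act L"
    proof (rule semisimple_has_complement[OF ss VA LA finite_UNIV, of "\<lambda>i. pure 1 (bas i)"])
      fix C assume C: "submodule_of A_ring ?act C" "range (\<lambda>i :: 'n. pure 1 (bas i)) \<subseteq> C"
      have C': "0 \<in> C" "\<And>x y. x \<in> C \<Longrightarrow> y \<in> C \<Longrightarrow> x + y \<in> C" "\<And>a x. x \<in> C \<Longrightarrow> pure a u \<natural> x \<in> C"
        using C(1) by (auto simp: submodule_of_def A_ring_def smash_emb)
      note sum_mem = sum_mem[OF C'(1,2)]
      have scale: "pw sc c x \<in> C" if "x \<in> C" for c x
        using C'(3)[OF that, of "sc c 1"] by (simp add: pure_scale smash_scale_left)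
      have one: "pure 1 h \<in> C" for h
        by (subst lin_expand[OF lin_pure0]) (use C(2) in \<open>auto intro!: sum_mem scale\<close>)
      \<comment> \<open>Multiplying 1 \<natural> h by a \<natural> 1 gives (a . h_2) \<natural> h_1
        instead of a \<natural> h, so generation over A also rests on the decomposition of a
        \<natural> S(g).\<close>
      have "pure a h \<in> C" for a h
      proof -
        obtain g where "h = ant g" using ant_surj by blast
        then show ?thesis
          unfolding pure_ant[of a g] \<open>h = ant g\<close> cop_def
          by (intro sum_mem scale C'(3) one)
      qed
      then have "(\<Sum>i\<in>UNIV. pure (x i) (bas i)) \<in> C" for x :: "'n \<Rightarrow> 'a" by (intro sum_mem)
      then show "C = UNIV" by (simp only: pure_expand[symmetric]) auto
    qed
  qed
  then have "\<exists>L'. left_ideal ?R L' \<and> L \<inter> L' = {0} \<and> (\<forall>x. \<exists>a\<in>L. \<exists>b\<in>L'. x = a + b)" if "left_ideal ?R L" for L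
    using that unfolding ideal has_complement_def by blast
  then show ?thesis
    using ring_smash_ring by (simp add: semisimple_artinian_def R)
qed

end

theorem theorem3p2:
  fixes m :: "'n::finite \<Rightarrow> 'n \<Rightarrow> 'n \<Rightarrow> 'k::field"
    and u eps :: "'n \<Rightarrow> 'k"
    and d :: "'n \<Rightarrow> 'n \<Rightarrow> 'n \<Rightarrow> 'k"
    and S :: "'n \<Rightarrow> 'n \<Rightarrow> 'k"
    and sc :: "'k \<Rightarrow> 'a::ring_1 \<Rightarrow> 'a"
    and lact :: "'n \<Rightarrow> 'a \<Rightarrow> 'a"
    and ract :: "'a \<Rightarrow> 'n \<Rightarrow> 'a"
  assumes hopf: "hopf_alg m u d eps S"
    and H_ss: "semisimple_artinian (H_ring m u)"
    and unimod: "dual_unimodular u d"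
    and bimod: "bimodule_algebra m u d eps sc lact ract"
  shows "(\<forall>(act :: ('n \<Rightarrow> 'a) \<Rightarrow> 'v::ab_group_add \<Rightarrow> 'v) W.
            lmodule (smash_ring m u d sc lact ract) act \<longrightarrow>
            submodule_of (smash_ring m u d sc lact ract) act W \<longrightarrow>
            has_complement A_ring (\<lambda>x. act (smash_emb u sc x)) W \<longrightarrow>
            has_complement (smash_ring m u d sc lact ract) act W)
       \<and> (semisimple_artinian (A_ring :: 'a ring) \<longrightarrow>
            semisimple_artinian (smash_ring m u d sc lact ract))"
proof -
  interpret hopf m u eps d S by unfold_locales (rule hopf)
  obtain t where t: "\<And>h. h \<bullet> t = pw (*) (cou h) t" "cou t = 1"
    using integral_exists[OF H_ss] by blast
  interpret integral_bimodule m u eps d S t sc lact ract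
    by unfold_locales (use t unimod bimod in auto)
  show ?thesis using smash_has_complement semisimple_smash_ring by blast
qed

end
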